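(* Let $N\ge1$, $0<p<1$, $\mu<\frac14$, and let $\beta_-=\frac12-\sqrt{\frac14-\mu}\in(0,\frac12)$. For given $v(0)>0$ and $C\in\mathbb{R}$ there exists near $r=R$, respectively near $r=r_0$, a unique local solution of $$u''+\frac{N-1}{r}u'+\frac{\mu}{\delta^2}u=u^p$$ of the following form, respectively (as $\delta\to0$): $$u(r)=\delta^{\beta_-}v(0)\Big(1+\frac{N-1}{2R}\delta+o(\delta)\Big)+C\delta^{\beta_+}\quad\text{if }\delta=R-r,$$ $$u(r)=\delta^{\beta_-}v(0)\Big(1-\frac{N-1}{2r_0}\delta+o(\delta)\Big)+C\delta^{\beta_+}\quad\text{if }\delta=r-r_0.$$
   Context: $\beta_+=\frac12+\sqrt{\frac14-\mu}$. The equation is that of radial solutions of $\Delta u+\frac{\mu}{\delta^2}u=u^p$ in the annulus $\{x\in\mathbb{R}^N:r_0<|x|<R\}$, $0<r_0<R$ (the case of a ball $B_R$ coincides with that of the outer boundary), where $\delta$ denotes the distance to the boundary. A local solution near $r=R$ (resp. $r=r_0$) is one defined for $0<\delta<\delta_0$ for some $\delta_0>0$. *)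

theory Defs
  imports Complex_Main "HOL-Library.Landau_Symbols"
begin

definition beta_minus :: "real \<Rightarrow> real" where
  "beta_minus \<mu> = 1/2 - sqrt (1/4 - \<mu>)"

definition beta_plus :: "real \<Rightarrow> real" where
  "beta_plus \<mu> = 1/2 + sqrt (1/4 - \<mu>)"

text \<open>For \<open>r0 < |x| < R\<close>, the distance of \<open>x\<close> to the boundary of the annulus,
  as a function of \<open>r = |x|\<close>.\<close>

definition annulus_dist :: "real \<Rightarrow> real \<Rightarrow> real \<Rightarrow> real" where
  "annulus_dist r0 R r = min (r - r0) (R - r)"

text \<open>Classical solutions on a set \<open>S\<close> of radii (open in all uses below). They are required to be
  nonnegative because \<open>u\<^sup>p\<close> with \<open>0 < p < 1\<close> is meant for \<open>u \<ge> 0\<close> only; note that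
  \<open>0 powr p = 0\<close>. Continuity of the second derivative follows from the equation.\<close>

definition radial_solution ::
  "nat \<Rightarrow> real \<Rightarrow> real \<Rightarrow> (real \<Rightarrow> real) \<Rightarrow> real set \<Rightarrow> (real \<Rightarrow> real) \<Rightarrow> bool" where
  "radial_solution N \<mu> p \<delta> S u \<longleftrightarrow>
     (\<forall>r\<in>S. 0 \<le> u r) \<and>
     (\<exists>u' u''. \<forall>r\<in>S.
        (u has_real_derivative u' r) (at r) \<and>
        (u' has_real_derivative u'' r) (at r) \<and>
        u'' r + (real N - 1) / r * u' r + \<mu> / (\<delta> r)\<^sup>2 * u r = u r powr p)"

text \<open>\<open>f t = t\<^bsup>\<beta>\<^sub>-\<^esup> v0 (1 + k t + o(t)) + C t\<^bsup>\<beta>\<^sub>+\<^esup>\<close> as \<open>t\<close> tends to \<open>0\<close> from the right.\<close>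

definition has_expansion ::
  "real \<Rightarrow> real \<Rightarrow> real \<Rightarrow> real \<Rightarrow> (real \<Rightarrow> real) \<Rightarrow> bool" where
  "has_expansion \<mu> v0 k C f \<longleftrightarrow>
     (\<exists>h. h \<in> o[at_right 0](\<lambda>t. t) \<and>
        (\<forall>\<^sub>F t in at_right 0.
           f t = t powr beta_minus \<mu> * v0 * (1 + k * t + h t) + C * t powr beta_plus \<mu>))"

text \<open>Here \<open>\<Omega>\<close> is the range of radii of the domain, \<open>\<delta>\<close> the distance to its whole boundary, and
  \<open>e r\<close> the distance to the boundary component under consideration; near that component \<open>e = \<delta>\<close>.
  A local solution is one on \<open>e r < d\<close> for some \<open>d > 0\<close>, where \<open>d\<close> depends on the
  solution. Uniqueness refers to all local solutions with the property \<open>form\<close>, whatever their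
  \<open>d\<close>: each of them agrees with \<open>u\<close> on the common part of the two neighbourhoods.\<close>

definition exists_unique_local_solution ::
  "nat \<Rightarrow> real \<Rightarrow> real \<Rightarrow> real set \<Rightarrow> (real \<Rightarrow> real) \<Rightarrow> (real \<Rightarrow> real) \<Rightarrow>
    ((real \<Rightarrow> real) \<Rightarrow> bool) \<Rightarrow> bool" where
  "exists_unique_local_solution N \<mu> p \<Omega> \<delta> e form \<longleftrightarrow>
     (\<exists>d0>0. \<exists>u.
        radial_solution N \<mu> p \<delta> {r\<in>\<Omega>. e r < d0} u \<and> form u \<and>
        (\<forall>d1>0. \<forall>w.
           radial_solution N \<mu> p \<delta> {r\<in>\<Omega>. e r < d1} w \<and> form w \<longrightarrow>
           (\<forall>r\<in>\<Omega>. e r < min d0 d1 \<longrightarrow> w r = u r)))"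

end

theory Submission imports Defs "HOL-Analysis.Analysis" begin

text \<open>Write \<open>r = \<rho> + \<sigma> t\<close> with \<open>\<sigma> = \<plusminus>1\<close>, where \<open>\<rho>\<close> is the radius of the boundary component
  and \<open>t\<close> the distance to it. With \<open>b = \<beta>\<^sub>-\<close>, \<open>u = t\<^sup>b v\<close>, \<open>E = (r / \<rho>)\<^bsup>N-1\<^esup>\<close> and \<open>q = E t\<^bsup>2b\<^esup> v'\<close>
  the equation becomes a first order system \<open>v' = t\<^bsup>-2b\<^esup> q / E\<close>, \<open>q' = t\<^bsup>2b-1\<^esup> g(t, v)\<close> with \<open>g\<close> continuous
  up to \<open>t = 0\<close>. Since \<open>0 < 2b < 1\<close> both weights are integrable, so the system has a unique local
  solution for given \<open>v(0)\<close> and \<open>q(0)\<close>, by contraction. L'Hopital's rule gives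
  \<open>v = v(0) + q(0) / (1 - 2b) t\<^bsup>1-2b\<^esup> + g(0, v(0)) / (2b) t + o(t)\<close>, which is the required expansion
  precisely when \<open>q(0) = (1 - 2b) C\<close>. As \<open>x \<mapsto> x\<^sup>p\<close> is concave, its chords ending at \<open>y > 0\<close> have slope
  at most \<open>y\<^bsup>p-1\<^esup>\<close>, so it is enough for uniqueness that one of the two solutions stays away from \<open>0\<close>.\<close>

section \<open>Integrals with a power weight\<close>

text \<open>The substitution \<open>s = r\<^sup>\<alpha>\<close> turns the improper integral of \<open>r\<^bsup>\<alpha>-1\<^esup> g(r)\<close> over \<open>[0, t]\<close> into the
  integral of a continuous function.\<close>

definition weighted_integral :: "real \<Rightarrow> (real \<Rightarrow> real) \<Rightarrow> real \<Rightarrow> real" where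
  "weighted_integral \<alpha> g t = integral {0..t powr \<alpha>} (\<lambda>s. g (s powr (1/\<alpha>))) / \<alpha>"

lemma continuous_on_weighted_integrand:
  fixes g :: "real \<Rightarrow> real"
  assumes "\<alpha> > 0" "continuous_on {0..d} g" "0 \<le> t" "t \<le> d"
  shows "continuous_on {0..t powr \<alpha>} (\<lambda>s. g (s powr (1/\<alpha>)))"
proof (rule continuous_on_compose2[OF assms(2)])
  show "continuous_on {0..t powr \<alpha>} (\<lambda>s. s powr (1/\<alpha>))"
    using assms by (intro continuous_on_powr' continuous_on_id continuous_on_const) auto
  have "s powr (1/\<alpha>) \<le> d" if "0 \<le> s" "s \<le> t powr \<alpha>" for s
  proof -
    have "s powr (1/\<alpha>) \<le> (t powr \<alpha>) powr (1/\<alpha>)" 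
      using that assms by (intro powr_mono2) auto
    also have "\<dots> = t" using assms by (simp add: powr_powr)
    finally show ?thesis using assms by simp
  qed
  then show "(\<lambda>s. s powr (1/\<alpha>)) ` {0..t powr \<alpha>} \<subseteq> {0..d}" by auto
qed

lemma weighted_integral_0 [simp]: "weighted_integral \<alpha> g 0 = 0"
  by (simp add: weighted_integral_def)

lemma continuous_on_weighted_integral:
  assumes "\<alpha> > 0" "continuous_on {0..d} g"
  shows "continuous_on {0..d} (weighted_integral \<alpha> g)"
proof (cases "d \<ge> 0")
  case True
  have "continuous_on {0..d powr \<alpha>} (\<lambda>x. integral {0..x} (\<lambda>s. g (s powr (1/\<alpha>))))"
    using continuous_on_weighted_integrand[OF assms True order_refl]
    by (intro indefinite_integral_continuous_1 integrable_continuous_real)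
  then have "continuous_on {0..d} (\<lambda>t. integral {0..t powr \<alpha>} (\<lambda>s. g (s powr (1/\<alpha>))))"
    by (rule continuous_on_compose2)
      (use assms in \<open>force intro!: continuous_on_powr' continuous_on_id continuous_on_const powr_mono2\<close>)+
  then show ?thesis
    unfolding weighted_integral_def using assms by (intro continuous_intros) auto
qed auto

text \<open>The fundamental theorem of calculus applies in the variable
  \<open>s = t powr \<alpha>\<close>; the factor \<open>\<alpha>\<close> produced by the chain rule
  is cancelled by the division in \<open>weighted_integral\<close>.\<close>

lemma has_real_derivative_weighted_integral:
  assumes "\<alpha> > 0" "continuous_on {0..d} g" "0 < t" "t < d"
  shows "(weighted_integral \<alpha> g has_real_derivative t powr (\<alpha> - 1) * g t) (at t)"
proof -
  define G where "G = (\<lambda>x. integral {0..x} (\<lambda>s. g (s powr (1/\<alpha>))))"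
  have "t powr \<alpha> < d powr \<alpha>"
    using assms by (intro powr_less_mono2) auto
  then have mem: "t powr \<alpha> \<in> {0<..<d powr \<alpha>}"
    using assms by simp
  have "(G has_real_derivative g ((t powr \<alpha>) powr (1/\<alpha>))) (at (t powr \<alpha>) within {0..d powr \<alpha>})"
    unfolding G_def using mem assms
    by (intro integral_has_real_derivative continuous_on_weighted_integrand[OF assms(1,2)]) simp_all
  then have "(G has_real_derivative g t) (at (t powr \<alpha>) within {0..d powr \<alpha>})"
    using assms by (simp add: powr_powr)
  then have G: "(G has_real_derivative g t) (at (t powr \<alpha>))"
    using mem by (simp add: at_within_Icc_at)
  have "((\<lambda>t. t powr \<alpha>) has_real_derivative \<alpha> * t powr (\<alpha> - 1)) (at t)"
    using assms by (auto intro!: derivative_eq_intros simp: powr_diff)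
  from DERIV_chain2[OF G this] 
  have "((\<lambda>t. G (t powr \<alpha>) / \<alpha>) has_real_derivative g t * (\<alpha> * t powr (\<alpha> - 1)) / \<alpha>) (at t)"
    by (rule DERIV_cdivide)
  then show ?thesis
    using assms by (simp add: weighted_integral_def[abs_def] G_def mult.commute)
qed

lemma weighted_integral_diff:
  assumes "\<alpha> > 0" "continuous_on {0..d} g" "continuous_on {0..d} h" "0 \<le> t" "t \<le> d"
  shows "weighted_integral \<alpha> g t - weighted_integral \<alpha> h t = weighted_integral \<alpha> (\<lambda>s. g s - h s) t"
  unfolding weighted_integral_def
  using assms continuous_on_weighted_integrand
  by (subst integral_diff) (auto intro!: integrable_continuous_real simp: diff_divide_distrib)

text \<open>After the substitution the interval of integration has length
  \<open>t powr \<alpha>\<close>, which accounts for the power of \<open>t\<close>.\<close>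

lemma weighted_integral_bound:
  assumes "\<alpha> > 0" "continuous_on {0..d} g" "0 \<le> t" "t \<le> d"
    and "\<And>s. 0 \<le> s \<Longrightarrow> s \<le> d \<Longrightarrow> \<bar>g s\<bar> \<le> B"
  shows "\<bar>weighted_integral \<alpha> g t\<bar> \<le> B * t powr \<alpha> / \<alpha>"
proof -
  have "norm (integral {0..t powr \<alpha>} (\<lambda>s. g (s powr (1/\<alpha>)))) \<le> B * (t powr \<alpha> - 0)"
  proof (rule integral_bound)
    fix s assume "s \<in> {0..t powr \<alpha>}"
    then have "s powr (1/\<alpha>) \<le> (t powr \<alpha>) powr (1/\<alpha>)" 
      using assms by (intro powr_mono2) auto
    also have "\<dots> = t" using assms by (simp add: powr_powr)
    finally show "norm (g (s powr (1/\<alpha>))) \<le> B" using assms by simp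
  qed (use assms continuous_on_weighted_integrand in auto)
  then show ?thesis
    using assms by (simp add: weighted_integral_def divide_right_mono)
qed

section \<open>A first order system with integrable singularities\<close>

text \<open>Conditions at 0 are left out: besides the construction of solutions with prescribed
  limits, the notion has to apply to a given solution before the limit of \<open>q\<close> is known
  to exist. Later \<open>\<alpha>\<close> is \<open>2 * b\<close> and \<open>H\<close> is
  \<open>1 / E\<close>.\<close>

definition singular_system ::
  "real \<Rightarrow> (real \<Rightarrow> real) \<Rightarrow> (real \<Rightarrow> real \<Rightarrow> real) \<Rightarrow> real \<Rightarrow> (real \<Rightarrow> real) \<Rightarrow> (real \<Rightarrow> real) \<Rightarrow> bool" where
  "singular_system \<alpha> H g d v q \<longleftrightarrow> (\<forall>t\<in>{0<..<d}.
     (v has_real_derivative t powr (- \<alpha>) * (H t * q t)) (at t) \<and>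
     (q has_real_derivative t powr (\<alpha> - 1) * g t (v t)) (at t))"

text \<open>This is the integrated system with \<open>q\<close> eliminated, solved by Banach's
  theorem in the sup norm. The two integrations contribute \<open>d powr \<alpha> / \<alpha>\<close>
  and \<open>d powr (1 - \<alpha>) / (1 - \<alpha>)\<close>, whose product is the factor
  \<open>d / (\<alpha> * (1 - \<alpha>))\<close> in the smallness hypothesis.\<close>

lemma singular_system_fixed_point:
  fixes H :: "real \<Rightarrow> real" and g :: "real \<Rightarrow> real \<Rightarrow> real"
  assumes \<alpha>: "0 < \<alpha>" "\<alpha> < 1" and d: "0 < d" and H: "continuous_on {0..d} H"
    and HL: "\<And>t. t \<in> {0..d} \<Longrightarrow> \<bar>H t\<bar> \<le> L"
    and g: "\<And>v. continuous_on {0..d} v \<Longrightarrow> continuous_on {0..d} (\<lambda>t. g t (v t))"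
    and gK: "\<And>t x y. t \<in> {0..d} \<Longrightarrow> \<bar>g t x - g t y\<bar> \<le> K * \<bar>x - y\<bar>"
    and small: "L * K * d / (\<alpha> * (1 - \<alpha>)) \<le> 1/2"
  obtains v where "continuous_on {0..d} v"
    "\<And>t. t \<in> {0..d} \<Longrightarrow> v t = v0 + weighted_integral (1 - \<alpha>)
       (\<lambda>s. H s * (c + weighted_integral \<alpha> (\<lambda>s. g s (v s)) s)) t"
proof -
  define Q where "Q v = (\<lambda>s. H s * (c + weighted_integral \<alpha> (\<lambda>s. g s (v s)) s))" for v
  \<comment> \<open>Clamping the argument to \<open>[0, d]\<close> extends the image by constants to
    the whole line, so that the map acts on the bounded continuous functions on the reals, a
    complete space.\<close>
  define F where "F v x = v0 + weighted_integral (1 - \<alpha>) (Q v) (max 0 (min d x))" for v x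
  have L0: "L \<ge> 0" using HL[of 0] d by auto
  have contQ: "continuous_on {0..d} (Q v)" if "continuous_on {0..d} v" for v
    unfolding Q_def using \<alpha> g[OF that] H
    by (intro continuous_intros continuous_on_weighted_integral) auto
  have clamp: "continuous_on UNIV (\<lambda>x::real. max 0 (min d x))"
    by (intro continuous_intros)
  have contF: "continuous_on UNIV (F v)" if "continuous_on {0..d} v" for v
    unfolding F_def using \<alpha> d
    by (intro continuous_intros continuous_on_compose2[OF continuous_on_weighted_integral[OF _ contQ[OF that], of "1 - \<alpha>"] clamp]) auto
  have bF: "bounded (range (F v))" if "continuous_on {0..d} v" for v
  proof -
    have "bounded (F v ` {0..d})"
      using contF[OF that] compact_continuous_image[of "{0..d}" "F v"] continuous_on_subset
      by (intro compact_imp_bounded) blast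
    moreover have "range (F v) \<subseteq> F v ` {0..d}"
    proof
      fix y assume "y \<in> range (F v)"
      then obtain x where "y = F v x" by auto
      then have "y = F v (max 0 (min d x))" using d by (auto simp: F_def)
      then show "y \<in> F v ` {0..d}" using d by auto
    qed
    ultimately show ?thesis using bounded_subset by blast
  qed
  define \<Phi> where "\<Phi> = (\<lambda>v::real \<Rightarrow>\<^sub>C real. Bcontfun (F (apply_bcontfun v)))"
  have cont_app: "continuous_on S (apply_bcontfun v)" for S and v :: "real \<Rightarrow>\<^sub>C real"
    using apply_bcontfun[of v] continuous_on_subset by (auto simp: bcontfun_def)
  have app: "apply_bcontfun (\<Phi> v) = F (apply_bcontfun v)" for v
    unfolding \<Phi>_def by (rule Bcontfun_inverse) (simp add: bcontfun_def contF bF cont_app)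
  have lip: "dist (\<Phi> v) (\<Phi> w) \<le> 1/2 * dist v w" for v w
  proof (rule dist_bound)
    fix x
    define y where "y = max 0 (min d x)"
    have y: "0 \<le> y" "y \<le> d" using d by (auto simp: y_def)
    define M where "M = dist v w"
    have M: "\<bar>apply_bcontfun v s - apply_bcontfun w s\<bar> \<le> M" for s
      using dist_bounded[of v s w] by (simp add: M_def dist_real_def)
    have M0: "M \<ge> 0" by (simp add: M_def)
    have K0: "K \<ge> 0" using gK[of 0 1 0] d by auto
    have inner: "\<bar>weighted_integral \<alpha> (\<lambda>s. g s (apply_bcontfun v s)) s
        - weighted_integral \<alpha> (\<lambda>s. g s (apply_bcontfun w s)) s\<bar> \<le> K * M * d powr \<alpha> / \<alpha>"
      if s: "0 \<le> s" "s \<le> d" for s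
    proof -
      have "\<bar>weighted_integral \<alpha> (\<lambda>s. g s (apply_bcontfun v s) - g s (apply_bcontfun w s)) s\<bar>
          \<le> K * M * s powr \<alpha> / \<alpha>"
      proof (rule weighted_integral_bound)
        show "continuous_on {0..d} (\<lambda>s. g s (apply_bcontfun v s) - g s (apply_bcontfun w s))"
          by (intro continuous_intros g cont_app)
        fix r assume "0 \<le> r" "r \<le> d"
        then have "\<bar>g r (apply_bcontfun v r) - g r (apply_bcontfun w r)\<bar>
            \<le> K * \<bar>apply_bcontfun v r - apply_bcontfun w r\<bar>" by (intro gK) auto
        also have "\<dots> \<le> K * M" using K0 M by (intro mult_left_mono) auto
        finally show "\<bar>g r (apply_bcontfun v r) - g r (apply_bcontfun w r)\<bar> \<le> K * M" .
      qed (use \<alpha> s in auto)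
      also have "\<dots> \<le> K * M * d powr \<alpha> / \<alpha>"
        using \<alpha> s K0 M0 by (intro divide_right_mono mult_left_mono powr_mono2) auto
      finally show ?thesis
        using s \<alpha> by (subst weighted_integral_diff[where d=d]) (auto intro!: g cont_app)
    qed
    have "\<bar>weighted_integral (1 - \<alpha>) (\<lambda>s. Q (apply_bcontfun v) s - Q (apply_bcontfun w) s) y\<bar>
        \<le> L * (K * M * d powr \<alpha> / \<alpha>) * y powr (1 - \<alpha>) / (1 - \<alpha>)"
    proof (rule weighted_integral_bound)
      show "continuous_on {0..d} (\<lambda>s. Q (apply_bcontfun v) s - Q (apply_bcontfun w) s)"
        by (intro continuous_intros contQ cont_app)
      fix s assume s: "0 \<le> s" "s \<le> d"
      have "Q (apply_bcontfun v) s - Q (apply_bcontfun w) s = H s * (weighted_integral \<alpha> (\<lambda>s. g s (apply_bcontfun v s)) s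
        - weighted_integral \<alpha> (\<lambda>s. g s (apply_bcontfun w s)) s)"
        by (simp add: Q_def algebra_simps)
      also have "\<bar>\<dots>\<bar> \<le> L * (K * M * d powr \<alpha> / \<alpha>)"
        unfolding abs_mult using s HL inner[OF s] L0 by (intro mult_mono) auto
      finally show "\<bar>Q (apply_bcontfun v) s - Q (apply_bcontfun w) s\<bar> \<le> L * (K * M * d powr \<alpha> / \<alpha>)" .
    qed (use \<alpha> y in auto)
    also have "\<dots> \<le> L * (K * M * d powr \<alpha> / \<alpha>) * d powr (1 - \<alpha>) / (1 - \<alpha>)"
      using \<alpha> y K0 M0 L0 by (intro divide_right_mono mult_left_mono powr_mono2) auto
    also have "\<dots> = L * K * (d powr \<alpha> * d powr (1 - \<alpha>)) / (\<alpha> * (1 - \<alpha>)) * M"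
      by (simp add: field_simps)
    also have "d powr \<alpha> * d powr (1 - \<alpha>) = d"
      using d by (simp flip: powr_add)
    also have "L * K * d / (\<alpha> * (1 - \<alpha>)) * M \<le> 1/2 * M"
      using small M0 by (rule mult_right_mono)
    finally show "dist (apply_bcontfun (\<Phi> v) x) (apply_bcontfun (\<Phi> w) x) \<le> 1/2 * dist v w"
      using y \<alpha> weighted_integral_diff[of "1 - \<alpha>" d "Q (apply_bcontfun v)" "Q (apply_bcontfun w)" y]
      by (simp add: app F_def dist_real_def M_def contQ cont_app flip: y_def)
  qed
  have "\<exists>!v. \<Phi> v = v"
    by (rule banach_fix_type[where c = "1/2"]) (use lip in auto)
  then obtain v where v: "\<Phi> v = v" by auto
  show ?thesis
  proof (rule that)
    show "continuous_on {0..d} (apply_bcontfun v)" by (rule cont_app)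
    fix t assume "t \<in> {0..d}"
    then have "F (apply_bcontfun v) t = v0 + weighted_integral (1 - \<alpha>) (Q (apply_bcontfun v)) t"
      by (simp add: F_def)
    then show "apply_bcontfun v t = v0 + weighted_integral (1 - \<alpha>)
       (\<lambda>s. H s * (c + weighted_integral \<alpha> (\<lambda>s. g s (apply_bcontfun v s)) s)) t"
      using app[of v] v by (simp add: Q_def)
  qed
qed

text \<open>Differentiating the fixed point equation gives the system on the open interval; the
  limits at 0 hold because both weighted integrals are continuous and vanish there.\<close>

lemma singular_system_exists:
  fixes H :: "real \<Rightarrow> real" and g :: "real \<Rightarrow> real \<Rightarrow> real"
  assumes \<alpha>: "0 < \<alpha>" "\<alpha> < 1" and d: "0 < d" and H: "continuous_on {0..d} H"
    and HL: "\<And>t. t \<in> {0..d} \<Longrightarrow> \<bar>H t\<bar> \<le> L"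
    and g: "\<And>v. continuous_on {0..d} v \<Longrightarrow> continuous_on {0..d} (\<lambda>t. g t (v t))"
    and gK: "\<And>t x y. t \<in> {0..d} \<Longrightarrow> \<bar>g t x - g t y\<bar> \<le> K * \<bar>x - y\<bar>"
    and small: "L * K * d / (\<alpha> * (1 - \<alpha>)) \<le> 1/2"
  obtains v q where "singular_system \<alpha> H g d v q"
    "(v \<longlongrightarrow> v0) (at_right 0)" "(q \<longlongrightarrow> c) (at_right 0)"
proof -
  obtain v where v: "continuous_on {0..d} v"
    and eq: "\<And>t. t \<in> {0..d} \<Longrightarrow> v t = v0 + weighted_integral (1 - \<alpha>)
       (\<lambda>s. H s * (c + weighted_integral \<alpha> (\<lambda>s. g s (v s)) s)) t"
    using singular_system_fixed_point[OF assms, of v0 c] by metis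
  define q where "q = (\<lambda>s. c + weighted_integral \<alpha> (\<lambda>s. g s (v s)) s)"
  have q: "continuous_on {0..d} q"
    unfolding q_def using \<alpha> g[OF v] by (intro continuous_intros continuous_on_weighted_integral)
  have Hq: "continuous_on {0..d} (\<lambda>s. H s * q s)"
    using H q by (intro continuous_intros)
  have eq: "v t = v0 + weighted_integral (1 - \<alpha>) (\<lambda>s. H s * q s) t" if "t \<in> {0..d}" for t
    using eq[OF that] by (simp add: q_def)
  show ?thesis
  proof (rule that)
    show "singular_system \<alpha> H g d v q"
      unfolding singular_system_def
    proof (intro ballI conjI)
      fix t assume t: "t \<in> {0<..<d}"
      have "((\<lambda>t. v0 + weighted_integral (1 - \<alpha>) (\<lambda>s. H s * q s) t) has_real_derivative
          t powr (- \<alpha>) * (H t * q t)) (at t)"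
        using has_real_derivative_weighted_integral[OF _ Hq, of "1 - \<alpha>" t] t \<alpha>
        by (auto intro!: derivative_eq_intros)
      then show "(v has_real_derivative t powr (- \<alpha>) * (H t * q t)) (at t)"
        by (rule has_field_derivative_transform_within_open[where S = "{0<..<d}"]) (use t eq in auto)
      show "(q has_real_derivative t powr (\<alpha> - 1) * g t (v t)) (at t)"
        unfolding q_def using has_real_derivative_weighted_integral[OF _ g[OF v], of \<alpha> t] t \<alpha>
        by (auto intro!: derivative_eq_intros)
    qed
    show "(v \<longlongrightarrow> v0) (at_right 0)"
      using continuous_on_Icc_at_rightD[OF v d] eq[of 0] d by simp
    show "(q \<longlongrightarrow> c) (at_right 0)"
      using continuous_on_Icc_at_rightD[OF q d] by (simp add: q_def)
  qed
qed


section \<open>Uniqueness for the system and behaviour of its solutions at the singular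
  endpoint\<close>

lemma nonneg_of_nonneg_derivative:
  fixes \<phi> :: "real \<Rightarrow> real"
  assumes lim: "(\<phi> \<longlongrightarrow> 0) (at_right 0)" and t: "0 < t"
    and deriv: "\<And>s. 0 < s \<Longrightarrow> s \<le> t \<Longrightarrow> (\<phi> has_real_derivative \<phi>' s) (at s)"
    and nonneg: "\<And>s. 0 < s \<Longrightarrow> s \<le> t \<Longrightarrow> 0 \<le> \<phi>' s"
  shows "0 \<le> \<phi> t"
proof (rule tendsto_upperbound[OF lim])
  have "\<forall>\<^sub>F s in at_right 0. s \<in> {0<..<t}"
    using t by (rule eventually_at_right_real)
  then show "\<forall>\<^sub>F s in at_right 0. \<phi> s \<le> \<phi> t"
  proof eventually_elim
    case (elim s)
    show ?case
    proof (rule DERIV_nonneg_imp_nondecreasing[where f = \<phi> and a = s and b = t])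
      show "\<exists>y. (\<phi> has_real_derivative y) (at x) \<and> 0 \<le> y" if "s \<le> x" "x \<le> t" for x
        using deriv[of x] nonneg[of x] that elim by (intro exI[of _ "\<phi>' x"]) simp
    qed (use elim in simp)
  qed
qed auto

text \<open>Both \<open>\<phi>\<close> and its negative are compared with
  \<open>B * s powr \<alpha> / \<alpha>\<close>, the antiderivative of the bound that tends to 0.
  This replaces an integration of \<open>\<phi>'\<close>, about whose integrability nothing is
  assumed.\<close>

lemma bound_of_derivative_bound:
  fixes \<phi> :: "real \<Rightarrow> real"
  assumes lim: "(\<phi> \<longlongrightarrow> 0) (at_right 0)" and t: "0 < t" and \<alpha>: "0 < \<alpha>"
    and deriv: "\<And>s. 0 < s \<Longrightarrow> s \<le> t \<Longrightarrow> (\<phi> has_real_derivative \<phi>' s) (at s)"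
    and bound: "\<And>s. 0 < s \<Longrightarrow> s \<le> t \<Longrightarrow> \<bar>\<phi>' s\<bar> \<le> B * s powr (\<alpha> - 1)"
  shows "\<bar>\<phi> t\<bar> \<le> B * t powr \<alpha> / \<alpha>"
proof -
  have pow: "((\<lambda>s. B * s powr \<alpha> / \<alpha>) \<longlongrightarrow> 0) (at_right 0)"
    using \<alpha> by (auto intro!: tendsto_eq_intros simp: eventually_at_filter)
  have dpow: "((\<lambda>s. B * s powr \<alpha> / \<alpha>) has_real_derivative B * s powr (\<alpha> - 1)) (at s)" if "0 < s" for s
    using that \<alpha> by (auto intro!: derivative_eq_intros simp: powr_diff)
  have "0 \<le> B * t powr \<alpha> / \<alpha> - \<phi> t"
  proof (rule nonneg_of_nonneg_derivative[where \<phi> = "\<lambda>s. B * s powr \<alpha> / \<alpha> - \<phi> s"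
        and \<phi>' = "\<lambda>s. B * s powr (\<alpha> - 1) - \<phi>' s"])
    show "((\<lambda>s. B * s powr \<alpha> / \<alpha> - \<phi> s) \<longlongrightarrow> 0) (at_right 0)"
      using tendsto_diff[OF pow lim] by simp
    fix s assume s: "0 < s" "s \<le> t"
    show "((\<lambda>s. B * s powr \<alpha> / \<alpha> - \<phi> s) has_real_derivative B * s powr (\<alpha> - 1) - \<phi>' s) (at s)"
      by (intro DERIV_diff dpow deriv s)
    show "0 \<le> B * s powr (\<alpha> - 1) - \<phi>' s" using bound[OF s] by linarith
  qed (rule t)
  moreover have "0 \<le> B * t powr \<alpha> / \<alpha> + \<phi> t"
  proof (rule nonneg_of_nonneg_derivative[where \<phi> = "\<lambda>s. B * s powr \<alpha> / \<alpha> + \<phi> s"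
        and \<phi>' = "\<lambda>s. B * s powr (\<alpha> - 1) + \<phi>' s"])
    show "((\<lambda>s. B * s powr \<alpha> / \<alpha> + \<phi> s) \<longlongrightarrow> 0) (at_right 0)"
      using tendsto_add[OF pow lim] by simp
    fix s assume s: "0 < s" "s \<le> t"
    show "((\<lambda>s. B * s powr \<alpha> / \<alpha> + \<phi> s) has_real_derivative B * s powr (\<alpha> - 1) + \<phi>' s) (at s)"
      by (intro DERIV_add dpow deriv s)
    show "0 \<le> B * s powr (\<alpha> - 1) + \<phi>' s" using bound[OF s] by linarith
  qed (rule t)
  ultimately show ?thesis by linarith
qed

text \<open>With \<open>M\<close> the maximum of the distance of \<open>v1\<close> and
  \<open>v2\<close> on \<open>[0, t]\<close>, integrating the two equations in turn bounds this
  distance by \<open>L * K * d / \<alpha> * M\<close>, hence \<open>M \<le> M / 2\<close>. The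
  Lipschitz estimate is required only along the two given solutions, so it may exploit that one of
  them is bounded away from 0.\<close>

lemma singular_system_unique:
  assumes \<alpha>: "0 < \<alpha>"
    and 1: "singular_system \<alpha> H g d v1 q1" and 2: "singular_system \<alpha> H g d v2 q2"
    and v1: "(v1 \<longlongrightarrow> v0) (at_right 0)" and v2: "(v2 \<longlongrightarrow> v0) (at_right 0)"
    and q1: "(q1 \<longlongrightarrow> c) (at_right 0)" and q2: "(q2 \<longlongrightarrow> c) (at_right 0)"
    and HL: "\<And>t. 0 < t \<Longrightarrow> t < d \<Longrightarrow> \<bar>H t\<bar> \<le> L"
    and gK: "\<And>t. 0 < t \<Longrightarrow> t < d \<Longrightarrow> \<bar>g t (v1 t) - g t (v2 t)\<bar> \<le> K * \<bar>v1 t - v2 t\<bar>"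
    and K: "0 \<le> K" and small: "L * K * d / \<alpha> \<le> 1/2" and t: "0 < t" "t < d"
  shows "v1 t = v2 t"
proof -
  have L: "0 \<le> L" using HL[OF t] by linarith
  \<comment> \<open>No values at 0 are prescribed. Setting the difference to 0 there, in accordance
    with the common limit, makes \<open>D\<close> continuous on the closed interval, so that it
    attains a maximum.\<close>
  define D where "D s = (if s \<le> 0 then 0 else \<bar>v1 s - v2 s\<bar>)" for s
  have dv: "((\<lambda>s. v1 s - v2 s) has_real_derivative s powr (- \<alpha>) * (H s * (q1 s - q2 s))) (at s)"
    and dq: "((\<lambda>s. q1 s - q2 s) has_real_derivative s powr (\<alpha> - 1) * (g s (v1 s) - g s (v2 s))) (at s)"
    if "0 < s" "s < d" for s
    using that 1 2 unfolding singular_system_def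
    by (auto intro!: derivative_eq_intros simp: algebra_simps)
  have lim: "((\<lambda>s. v1 s - v2 s) \<longlongrightarrow> 0) (at_right 0)" "((\<lambda>s. q1 s - q2 s) \<longlongrightarrow> 0) (at_right 0)"
    using tendsto_diff[OF v1 v2] tendsto_diff[OF q1 q2] by auto
  have contD: "(D \<longlongrightarrow> D s) (at s)" if "0 < s" "s < d" for s
  proof -
    have "((\<lambda>s. \<bar>v1 s - v2 s\<bar>) \<longlongrightarrow> D s) (at s)"
      using DERIV_isCont[OF dv[OF that]] that unfolding D_def isCont_def by (auto intro: tendsto_rabs)
    then show ?thesis
    proof (rule Lim_transform_eventually)
      have "\<forall>\<^sub>F x in at s. x \<in> {0<..}"
        using that by (intro eventually_at_in_open') auto
      then show "\<forall>\<^sub>F x in at s. \<bar>v1 x - v2 x\<bar> = D x"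
        by eventually_elim (auto simp: D_def)
    qed
  qed
  have "continuous_on {0..t} D"
  proof (rule continuous_on_IccI)
    have "((\<lambda>s. \<bar>v1 s - v2 s\<bar>) \<longlongrightarrow> D 0) (at_right 0)"
      using tendsto_rabs[OF lim(1)] by (simp add: D_def)
    then show "(D \<longlongrightarrow> D 0) (at_right 0)"
      by (rule Lim_transform_eventually) (auto simp: D_def eventually_at_filter)
    show "(D \<longlongrightarrow> D t) (at_left t)"
      using contD[OF t] by (rule filterlim_mono) (auto simp: at_le)
  qed (use contD t in auto)
  then obtain s0 where s0: "s0 \<in> {0..t}" and max: "\<And>s. s \<in> {0..t} \<Longrightarrow> D s \<le> D s0"
    using continuous_attains_sup[of "{0..t}" D] t by auto
  define M where "M = D s0"
  have M0: "M \<ge> 0" by (simp add: M_def D_def)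
  have M: "\<bar>v1 s - v2 s\<bar> \<le> M" if "0 < s" "s \<le> t" for s
    using max[of s] that by (auto simp: M_def D_def)
  have qb: "\<bar>q1 s - q2 s\<bar> \<le> K * M * s powr \<alpha> / \<alpha>" if s: "0 < s" "s \<le> t" for s
  proof (rule bound_of_derivative_bound[OF lim(2)])
    fix r assume r: "0 < r" "r \<le> s"
    show "((\<lambda>s. q1 s - q2 s) has_real_derivative r powr (\<alpha> - 1) * (g r (v1 r) - g r (v2 r))) (at r)"
      using dq r s t by auto
    have "\<bar>g r (v1 r) - g r (v2 r)\<bar> \<le> K * \<bar>v1 r - v2 r\<bar>"
      using r s t by (intro gK) auto
    also have "\<dots> \<le> K * M" using K M r s by (intro mult_left_mono) auto
    finally show "\<bar>r powr (\<alpha> - 1) * (g r (v1 r) - g r (v2 r))\<bar> \<le> K * M * r powr (\<alpha> - 1)"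
      unfolding abs_mult by (subst mult.commute, intro mult_mono) auto
  qed (use s \<alpha> in auto)
  have "M = 0"
  proof (cases "s0 = 0")
    case False
    with s0 have s0': "0 < s0" "s0 \<le> t" by auto
    \<comment> \<open>The weight \<open>r powr (- \<alpha>)\<close> cancels the factor
      \<open>r powr \<alpha>\<close> gained in the bound on \<open>q1 - q2\<close>. The derivative
      is therefore bounded, which is the case of exponent 1 in the comparison lemma.\<close>
    have "\<bar>v1 s0 - v2 s0\<bar> \<le> L * (K * M / \<alpha>) * s0 powr 1 / 1"
    proof (rule bound_of_derivative_bound[OF lim(1)])
      fix r assume r: "0 < r" "r \<le> s0"
      show "((\<lambda>s. v1 s - v2 s) has_real_derivative r powr (- \<alpha>) * (H r * (q1 r - q2 r))) (at r)"
        using dv r s0' t by auto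
      have "\<bar>H r * (q1 r - q2 r)\<bar> \<le> L * (K * M * r powr \<alpha> / \<alpha>)"
        unfolding abs_mult using r s0' t L HL qb by (intro mult_mono) auto
      then have "\<bar>r powr (- \<alpha>) * (H r * (q1 r - q2 r))\<bar> \<le> r powr (- \<alpha>) * (L * (K * M * r powr \<alpha> / \<alpha>))"
        unfolding abs_mult[of "r powr (- \<alpha>)"] by (intro mult_mono) auto
      also have "\<dots> = L * (K * M / \<alpha>) * (r powr (- \<alpha>) * r powr \<alpha>)"
        by (simp add: field_simps)
      also have "r powr (- \<alpha>) * r powr \<alpha> = r powr (1 - 1)"
        using r by (simp flip: powr_add)
      finally show "\<bar>r powr (- \<alpha>) * (H r * (q1 r - q2 r))\<bar> \<le> L * (K * M / \<alpha>) * r powr (1 - 1)" .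
    qed (use s0' in auto)
    also have "\<dots> = L * (K * M / \<alpha>) * s0" using s0' by simp
    also have "\<dots> \<le> L * (K * M / \<alpha>) * d"
      using s0' t L K M0 \<alpha> by (intro mult_left_mono) auto
    also have "\<dots> = L * K * d / \<alpha> * M" by simp
    also have "\<dots> \<le> 1/2 * M" using small M0 by (rule mult_right_mono)
    finally show ?thesis using s0' M0 by (simp add: M_def D_def)
  qed (auto simp: M_def D_def)
  then show ?thesis using M[of t] t by simp
qed

text \<open>Integrability of the weight forces the limit to exist: near 0, \<open>q\<close> differs
  by a constant from the weighted integral of \<open>G\<close>, extended by \<open>l\<close> at 0,
  and this integral tends to 0. The lemma supplies \<open>q(0)\<close> for a solution of which only
  the expansion is known.\<close>

lemma limit_of_weighted_derivative:
  fixes q :: "real \<Rightarrow> real"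
  assumes \<alpha>: "0 < \<alpha>" and d: "0 < d"
    and deriv: "\<And>t. 0 < t \<Longrightarrow> t < d \<Longrightarrow> (q has_real_derivative t powr (\<alpha> - 1) * G t) (at t)"
    and cont: "\<And>t. 0 < t \<Longrightarrow> t < d \<Longrightarrow> isCont G t" and lim: "(G \<longlongrightarrow> l) (at_right 0)"
  obtains c where "(q \<longlongrightarrow> c) (at_right 0)"
proof -
  \<comment> \<open>Continuity of \<open>G\<close> is available inside \<open>(0, d)\<close> only,
    so the closed interval on which its extension is integrated ends at
    \<open>d / 2\<close>.\<close>
  define d' where "d' = d / 2"
  have d': "0 < d'" "d' < d" using d by (auto simp: d'_def)
  define F where "F s = (if s \<le> 0 then l else G s)" for s
  have contF: "(F \<longlongrightarrow> F s) (at s)" if "0 < s" "s < d" for s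
  proof -
    have "(G \<longlongrightarrow> F s) (at s)"
      using cont[OF that] that unfolding F_def isCont_def by auto
    then show ?thesis
    proof (rule Lim_transform_eventually)
      have "\<forall>\<^sub>F x in at s. x \<in> {0<..}"
        using that by (intro eventually_at_in_open') auto
      then show "\<forall>\<^sub>F x in at s. G x = F x"
        by eventually_elim (auto simp: F_def)
    qed
  qed
  have F: "continuous_on {0..d'} F"
  proof (rule continuous_on_IccI)
    have "(G \<longlongrightarrow> F 0) (at_right 0)"
      using lim by (simp add: F_def)
    then show "(F \<longlongrightarrow> F 0) (at_right 0)"
      by (rule Lim_transform_eventually) (auto simp: F_def eventually_at_filter)
    show "(F \<longlongrightarrow> F d') (at_left d')"
      using contF[OF d'] by (rule filterlim_mono) (auto simp: at_le)
  qed (use contF d' in auto)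
  let ?W = "weighted_integral \<alpha> F"
  have "((\<lambda>t. q t - ?W t) has_real_derivative 0) (at t within {0<..<d'})" if "t \<in> {0<..<d'}" for t
  proof (rule has_field_derivative_at_within)
    have "(?W has_real_derivative t powr (\<alpha> - 1) * G t) (at t)"
      using has_real_derivative_weighted_integral[OF \<alpha> F, of t] that by (simp add: F_def)
    from DERIV_diff[OF deriv this] show "((\<lambda>t. q t - ?W t) has_real_derivative 0) (at t)"
      using that d' by simp
  qed
  then obtain c where c: "\<And>t. t \<in> {0<..<d'} \<Longrightarrow> q t - ?W t = c"
    using has_field_derivative_zero_constant[of "{0<..<d'}" "\<lambda>t. q t - ?W t"] by auto
  have "((\<lambda>t. c + ?W t) \<longlongrightarrow> c + 0) (at_right 0)"
    using continuous_on_Icc_at_rightD[OF continuous_on_weighted_integral[OF \<alpha> F] d'(1)]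
    by (intro tendsto_add) auto
  moreover have "\<forall>\<^sub>F t in at_right 0. c + ?W t = q t"
    using eventually_at_right_real[OF d'(1)] by eventually_elim (use c in force)
  ultimately have "(q \<longlongrightarrow> c) (at_right 0)"
    by (auto intro: Lim_transform_eventually)
  then show ?thesis by (rule that)
qed

text \<open>L'Hopital's rule is applied three times. The first limit recovers \<open>c\<close> from
  the leading deviation of \<open>v\<close> from \<open>v0\<close> and serves uniqueness; the second
  is the expansion and serves existence. The condition on \<open>(H t - 1) / t powr \<alpha>\<close>
  keeps the variation of \<open>H\<close> out of the term linear in \<open>t\<close>.\<close>

lemma singular_system_asymptotics:
  assumes \<alpha>: "0 < \<alpha>" "\<alpha> < 1" and d: "0 < d" and sys: "singular_system \<alpha> H g d v q"
    and v: "(v \<longlongrightarrow> v0) (at_right 0)" and q: "(q \<longlongrightarrow> c) (at_right 0)"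
    and g: "((\<lambda>t. g t (v t)) \<longlongrightarrow> g0) (at_right 0)"
    and H: "(H \<longlongrightarrow> 1) (at_right 0)" and H1: "((\<lambda>t. (H t - 1) / t powr \<alpha>) \<longlongrightarrow> 0) (at_right 0)"
  shows "((\<lambda>t. (v t - v0) / t powr (1 - \<alpha>)) \<longlongrightarrow> c / (1 - \<alpha>)) (at_right 0)" (is ?A)
    and "((\<lambda>t. (v t - v0 - c / (1 - \<alpha>) * t powr (1 - \<alpha>) - g0 / \<alpha> * t) / t) \<longlongrightarrow> 0) (at_right 0)" (is ?B)
proof -
  have ev: "\<forall>\<^sub>F t in at_right 0. t \<in> {0<..<d}"
    using d by (rule eventually_at_right_real)
  have pow: "((\<lambda>t::real. t powr e) \<longlongrightarrow> 0) (at_right 0)" if "0 < e" for e :: real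
    using that by (auto intro!: tendsto_eq_intros simp: eventually_at_filter)
  have dv: "\<forall>\<^sub>F t in at_right 0. (v has_real_derivative t powr (- \<alpha>) * (H t * q t)) (at t)"
    and dq: "\<forall>\<^sub>F t in at_right 0. (q has_real_derivative t powr (\<alpha> - 1) * g t (v t)) (at t)"
    using sys by (auto simp: singular_system_def intro: eventually_mono[OF ev])
  have dpow: "\<forall>\<^sub>F t in at_right 0. ((\<lambda>t. t powr e) has_real_derivative e * t powr (e - 1)) (at t)" for e :: real
    using ev by eventually_elim (auto intro!: derivative_eq_intros simp: powr_diff)
  show ?A
  proof (rule lhopital_right_0)
    show "((\<lambda>t. v t - v0) \<longlongrightarrow> 0) (at_right 0)" using tendsto_diff[OF v tendsto_const, of v0] by simp
    show "((\<lambda>t. t powr (1 - \<alpha>)) \<longlongrightarrow> 0) (at_right 0)" using \<alpha> by (intro pow) auto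
    show "\<forall>\<^sub>F t in at_right 0. t powr (1 - \<alpha>) \<noteq> 0" using ev by eventually_elim auto
    show "\<forall>\<^sub>F t in at_right 0. (1 - \<alpha>) * t powr (1 - \<alpha> - 1) \<noteq> 0" using ev by eventually_elim (use \<alpha> in auto)
    show "\<forall>\<^sub>F t in at_right 0. ((\<lambda>t. v t - v0) has_real_derivative t powr (- \<alpha>) * (H t * q t)) (at t)"
      using dv by eventually_elim (auto intro!: derivative_eq_intros)
    show "\<forall>\<^sub>F t in at_right 0. ((\<lambda>t. t powr (1 - \<alpha>)) has_real_derivative (1 - \<alpha>) * t powr (1 - \<alpha> - 1)) (at t)"
      by (rule dpow)
    have "((\<lambda>t. H t * q t / (1 - \<alpha>)) \<longlongrightarrow> 1 * c / (1 - \<alpha>)) (at_right 0)"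
      using \<alpha> by (intro tendsto_intros H q) auto
    then have "((\<lambda>t. H t * q t / (1 - \<alpha>)) \<longlongrightarrow> c / (1 - \<alpha>)) (at_right 0)"
      by simp
    then show "((\<lambda>t. t powr (- \<alpha>) * (H t * q t) / ((1 - \<alpha>) * t powr (1 - \<alpha> - 1))) \<longlongrightarrow> c / (1 - \<alpha>)) (at_right 0)"
      by (rule Lim_transform_eventually) (use ev in \<open>eventually_elim, auto\<close>)
  qed
  \<comment> \<open>The rate at which \<open>q\<close> approaches \<open>c\<close> decides the
    quotient of derivatives in the last application of the rule.\<close>
  have qa: "((\<lambda>t. (q t - c) / t powr \<alpha>) \<longlongrightarrow> g0 / \<alpha>) (at_right 0)"
  proof (rule lhopital_right_0)
    show "((\<lambda>t. q t - c) \<longlongrightarrow> 0) (at_right 0)" using tendsto_diff[OF q tendsto_const, of c] by simp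
    show "((\<lambda>t. t powr \<alpha>) \<longlongrightarrow> 0) (at_right 0)" using \<alpha> by (intro pow) auto
    show "\<forall>\<^sub>F t in at_right 0. t powr \<alpha> \<noteq> 0" using ev by eventually_elim auto
    show "\<forall>\<^sub>F t in at_right 0. \<alpha> * t powr (\<alpha> - 1) \<noteq> 0" using ev by eventually_elim (use \<alpha> in auto)
    show "\<forall>\<^sub>F t in at_right 0. ((\<lambda>t. q t - c) has_real_derivative t powr (\<alpha> - 1) * g t (v t)) (at t)"
      using dq by eventually_elim (auto intro!: derivative_eq_intros)
    show "\<forall>\<^sub>F t in at_right 0. ((\<lambda>t. t powr \<alpha>) has_real_derivative \<alpha> * t powr (\<alpha> - 1)) (at t)"
      by (rule dpow)
    have "((\<lambda>t. g t (v t) / \<alpha>) \<longlongrightarrow> g0 / \<alpha>) (at_right 0)"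
      using \<alpha> by (intro tendsto_intros g) auto
    then show "((\<lambda>t. t powr (\<alpha> - 1) * g t (v t) / (\<alpha> * t powr (\<alpha> - 1))) \<longlongrightarrow> g0 / \<alpha>) (at_right 0)"
      by (rule Lim_transform_eventually) (use ev in \<open>eventually_elim, auto\<close>)
  qed
  show ?B
  proof (rule lhopital_right_0)
    have "((\<lambda>t. v t - v0 - c / (1 - \<alpha>) * t powr (1 - \<alpha>) - g0 / \<alpha> * t) \<longlongrightarrow>
        v0 - v0 - c / (1 - \<alpha>) * 0 - g0 / \<alpha> * 0) (at_right 0)"
      using \<alpha> by (intro tendsto_intros v pow) auto
    then show "((\<lambda>t. v t - v0 - c / (1 - \<alpha>) * t powr (1 - \<alpha>) - g0 / \<alpha> * t) \<longlongrightarrow> 0) (at_right 0)"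
      by simp
    show "((\<lambda>t. t) \<longlongrightarrow> (0::real)) (at_right 0)" by (rule tendsto_ident_at)
    show "\<forall>\<^sub>F t::real in at_right 0. t \<noteq> 0" using ev by eventually_elim auto
    show "\<forall>\<^sub>F t::real in at_right 0. (1::real) \<noteq> 0" by simp
    show "\<forall>\<^sub>F t in at_right 0. ((\<lambda>t. v t - v0 - c / (1 - \<alpha>) * t powr (1 - \<alpha>) - g0 / \<alpha> * t)
        has_real_derivative t powr (- \<alpha>) * (H t * q t) - c * t powr (- \<alpha>) - g0 / \<alpha>) (at t)"
    proof (use dv ev in eventually_elim)
      case (elim t)
      have "((\<lambda>t. t powr (1 - \<alpha>)) has_real_derivative (1 - \<alpha>) * t powr (- \<alpha>)) (at t)"
        using elim has_real_derivative_powr[of t "1 - \<alpha>"] by simp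
      then have "((\<lambda>t. v t - v0 - c / (1 - \<alpha>) * t powr (1 - \<alpha>) - g0 / \<alpha> * t)
        has_real_derivative t powr (- \<alpha>) * (H t * q t) - 0 - c / (1 - \<alpha>) * ((1 - \<alpha>) * t powr (- \<alpha>)) - g0 / \<alpha> * 1) (at t)"
        using elim(1) by (intro DERIV_diff DERIV_cmult DERIV_const DERIV_ident)
      then show ?case using \<alpha> by simp
    qed
    \<comment> \<open>This is that quotient after the splitting
      \<open>H * q - c = H * (q - c) + c * (H - 1)\<close>.\<close>
    have "((\<lambda>t. H t * ((q t - c) / t powr \<alpha>) + c * ((H t - 1) / t powr \<alpha>) - g0 / \<alpha>) \<longlongrightarrow>
        1 * (g0 / \<alpha>) + c * 0 - g0 / \<alpha>) (at_right 0)"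
      by (intro tendsto_intros H qa H1)
    then have "((\<lambda>t. H t * ((q t - c) / t powr \<alpha>) + c * ((H t - 1) / t powr \<alpha>) - g0 / \<alpha>) \<longlongrightarrow> 0) (at_right 0)"
      by simp
    then show "((\<lambda>t. (t powr (- \<alpha>) * (H t * q t) - c * t powr (- \<alpha>) - g0 / \<alpha>) / 1) \<longlongrightarrow> 0) (at_right 0)"
      by (rule Lim_transform_eventually)
        (use ev in \<open>eventually_elim, simp add: powr_minus divide_inverse algebra_simps\<close>)
  qed (auto intro: DERIV_ident)
qed

section \<open>The equation near a boundary component\<close>

text \<open>As \<open>beta_plus \<mu> = 1 - b\<close>, division by \<open>t powr b\<close> turns the
  last term into \<open>C * t powr (1 - 2 * b)\<close>. For \<open>v0 \<noteq> 0\<close> the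
  remainder \<open>h\<close> is then determined by \<open>f\<close>, so its existence becomes a
  limit statement about \<open>f\<close> alone.\<close>

lemma has_expansion_iff:
  assumes \<mu>: "beta_minus \<mu> = b" and v0: "v0 \<noteq> 0"
  shows "has_expansion \<mu> v0 k C f \<longleftrightarrow>
    ((\<lambda>t. (t powr (- b) * f t - v0 - C * t powr (1 - 2 * b) - v0 * k * t) / t) \<longlongrightarrow> 0) (at_right 0)"
    (is "_ \<longleftrightarrow> ((\<lambda>t. ?r t / t) \<longlongrightarrow> 0) _")
proof -
  have plus: "beta_plus \<mu> = 1 - b" using \<mu> by (simp add: beta_minus_def beta_plus_def)
  have pos: "\<forall>\<^sub>F t::real in at_right 0. 0 < t" by (simp add: eventually_at_filter)
  have eq: "f t = t powr beta_minus \<mu> * v0 * (1 + k * t + h) + C * t powr beta_plus \<mu> \<longleftrightarrow> ?r t = v0 * h"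
    if "0 < t" for t h
  proof -
    have "t powr b * ?r t = f t - (t powr b * v0 * (1 + k * t) + C * t powr (1 - b))"
      using that by (simp add: algebra_simps powr_minus flip: powr_add)
    moreover have "t powr b * (?r t - v0 * h) = t powr b * ?r t - t powr b * v0 * h"
      by (simp add: algebra_simps)
    ultimately have "t powr b * (?r t - v0 * h) = f t - (t powr b * v0 * (1 + k * t + h) + C * t powr (1 - b))"
      by (simp add: algebra_simps)
    then show ?thesis using that unfolding \<mu> plus by (metis eq_iff_diff_eq_0 mult_eq_0_iff powr_eq_0_iff less_irrefl)
  qed
  show ?thesis
  proof
    assume "has_expansion \<mu> v0 k C f"
    then obtain h where h: "h \<in> o[at_right 0](\<lambda>t. t)"
      and f: "\<forall>\<^sub>F t in at_right 0. f t = t powr beta_minus \<mu> * v0 * (1 + k * t + h t) + C * t powr beta_plus \<mu>"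
      unfolding has_expansion_def by blast
    have "((\<lambda>t. v0 * (h t / t)) \<longlongrightarrow> v0 * 0) (at_right 0)"
      using smalloD_tendsto[OF h] by (intro tendsto_intros)
    then have "((\<lambda>t. v0 * (h t / t)) \<longlongrightarrow> 0) (at_right 0)" by simp
    then show "((\<lambda>t. ?r t / t) \<longlongrightarrow> 0) (at_right 0)"
    proof (rule Lim_transform_eventually)
      show "\<forall>\<^sub>F t in at_right 0. v0 * (h t / t) = ?r t / t"
        using f pos by eventually_elim (simp only: eq, simp)
    qed
  next
    assume lim: "((\<lambda>t. ?r t / t) \<longlongrightarrow> 0) (at_right 0)"
    show "has_expansion \<mu> v0 k C f"
      unfolding has_expansion_def
    proof (intro exI conjI)
      have "((\<lambda>t. ?r t / t / v0) \<longlongrightarrow> 0 / v0) (at_right 0)"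
        using lim v0 by (intro tendsto_intros)
      then have "((\<lambda>t. ?r t / v0 / t) \<longlongrightarrow> 0) (at_right 0)" by (simp add: mult.commute)
      then show "(\<lambda>t. ?r t / v0) \<in> o[at_right 0](\<lambda>t. t)"
        by (rule smalloI_tendsto) (use pos in \<open>eventually_elim, auto\<close>)
      show "\<forall>\<^sub>F t in at_right 0. f t = t powr beta_minus \<mu> * v0 * (1 + k * t + ?r t / v0) + C * t powr beta_plus \<mu>"
        using pos by eventually_elim (simp only: eq, simp add: v0)
    qed
  qed
qed

text \<open>The two parameters can be read off the expansion: terms of order \<open>t\<close> are
  negligible against \<open>t powr (1 - \<alpha>)\<close>, which itself tends to 0.\<close>

lemma tendsto_of_expansion:
  fixes v :: "real \<Rightarrow> real"
  assumes \<alpha>: "0 < \<alpha>" "\<alpha> < 1"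
    and lim: "((\<lambda>t. (v t - v0 - C * t powr (1 - \<alpha>) - l * t) / t) \<longlongrightarrow> 0) (at_right 0)"
  shows "(v \<longlongrightarrow> v0) (at_right 0)"
    and "((\<lambda>t. (v t - v0) / t powr (1 - \<alpha>)) \<longlongrightarrow> C) (at_right 0)"
proof -
  define h where "h = (\<lambda>t. (v t - v0 - C * t powr (1 - \<alpha>) - l * t) / t)"
  have h: "(h \<longlongrightarrow> 0) (at_right 0)" using lim by (simp add: h_def)
  have pos: "\<forall>\<^sub>F t::real in at_right 0. 0 < t" by (simp add: eventually_at_filter)
  have pow: "((\<lambda>t::real. t powr e) \<longlongrightarrow> 0) (at_right 0)" if "0 < e" for e :: real
    using that by (auto intro!: tendsto_eq_intros simp: eventually_at_filter)
  have "((\<lambda>t. C + (l + h t) * t powr \<alpha>) \<longlongrightarrow> C + (l + 0) * 0) (at_right 0)"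
    using \<alpha> by (intro tendsto_intros pow h)
  then have "((\<lambda>t. C + (l + h t) * t powr \<alpha>) \<longlongrightarrow> C) (at_right 0)" by simp
  then show *: "((\<lambda>t. (v t - v0) / t powr (1 - \<alpha>)) \<longlongrightarrow> C) (at_right 0)"
  proof (rule Lim_transform_eventually)
    show "\<forall>\<^sub>F t in at_right 0. C + (l + h t) * t powr \<alpha> = (v t - v0) / t powr (1 - \<alpha>)"
      using pos
    proof eventually_elim
      case (elim t)
      then have "v t - v0 = C * t powr (1 - \<alpha>) + (l + h t) * t" by (simp add: h_def field_simps)
      then show ?case using elim by (simp add: powr_diff field_simps)
    qed
  qed
  have "((\<lambda>t. v0 + (v t - v0) / t powr (1 - \<alpha>) * t powr (1 - \<alpha>)) \<longlongrightarrow> v0 + C * 0) (at_right 0)"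
    using \<alpha> by (intro tendsto_intros * pow) auto
  then have "((\<lambda>t. v0 + (v t - v0) / t powr (1 - \<alpha>) * t powr (1 - \<alpha>)) \<longlongrightarrow> v0) (at_right 0)" by simp
  then show "(v \<longlongrightarrow> v0) (at_right 0)"
    by (rule Lim_transform_eventually) (use pos in \<open>eventually_elim, simp\<close>)
qed

text \<open>Writing \<open>x powr p = x * x powr (p - 1)\<close> and using that the power
  \<open>p - 1\<close> is decreasing bounds the slope of the chord by \<open>y powr (p - 1)\<close>,
  hence by \<open>m powr (p - 1)\<close>. Only \<open>y\<close> is kept away from 0;
  \<open>x\<close> may vanish.\<close>

lemma powr_lipschitz:
  fixes x y m p :: real
  assumes "0 < p" "p < 1" "0 < m" "m \<le> y" "0 \<le> x"
  shows "\<bar>x powr p - y powr p\<bar> \<le> m powr (p - 1) * \<bar>x - y\<bar>"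
proof -
  have y: "y powr p = y * y powr (p - 1)" using assms by (simp add: powr_diff)
  have "\<bar>x powr p - y powr p\<bar> \<le> y powr (p - 1) * \<bar>x - y\<bar>"
  proof (cases "x = 0")
    case False
    then have x: "x powr p = x * x powr (p - 1)" using assms by (simp add: powr_diff)
    show ?thesis
    proof (cases "x \<le> y")
      case True
      have "y powr (p - 1) \<le> x powr (p - 1)"
        using assms False True by (intro powr_mono2') auto
      then have "x * y powr (p - 1) \<le> x powr p" 
        unfolding x using assms by (intro mult_left_mono) auto
      moreover have "x powr p \<le> y powr p" using assms True by (intro powr_mono2) auto
      ultimately show ?thesis using True y by (simp add: algebra_simps)
    next
      case False
      have "x powr (p - 1) \<le> y powr (p - 1)"
        using assms False by (intro powr_mono2') auto
      then have "x powr p \<le> x * y powr (p - 1)" 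
        unfolding x using assms by (intro mult_left_mono) auto
      moreover have "y powr p \<le> x powr p" using assms False by (intro powr_mono2) auto
      ultimately show ?thesis using False y by (simp add: algebra_simps)
    qed
  qed (use assms y in simp)
  also have "\<dots> \<le> m powr (p - 1) * \<bar>x - y\<bar>"
    using assms by (intro mult_right_mono powr_mono2') auto
  finally show ?thesis .
qed

text \<open>The equation in the variable \<open>t\<close>, the distance to the boundary component: \<open>a\<close> is the
  coefficient of the first derivative, \<open>E\<close> its integrating factor, and \<open>\<mu> = b - b\<^sup>2\<close>.\<close>

locale boundary_equation =
  fixes b p D :: real and a E :: "real \<Rightarrow> real"
  assumes b: "0 < b" "b < 1/2" and p: "0 < p" "p < 1" and D: "0 < D"
    and cont_a: "continuous_on {0..D} a"
    and E_pos: "\<And>t. t \<in> {0..D} \<Longrightarrow> 0 < E t" and E_0: "E 0 = 1"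
    and E_deriv: "\<And>t. t \<in> {0..D} \<Longrightarrow> (E has_real_derivative a t * E t) (at t within {0..D})"
begin

definition solution :: "real \<Rightarrow> (real \<Rightarrow> real) \<Rightarrow> bool" where
  "solution d f \<longleftrightarrow> (\<forall>t\<in>{0<..<d}. 0 \<le> f t) \<and> (\<exists>f' f''. \<forall>t\<in>{0<..<d}.
     (f has_real_derivative f' t) (at t) \<and> (f' has_real_derivative f'' t) (at t) \<and>
     f'' t + a t * f' t + (b - b\<^sup>2) / t\<^sup>2 * f t = f t powr p)"

text \<open>This is what remains of \<open>q'\<close> after division by
  \<open>t powr (2 * b - 1)\<close>; the terms singular like the inverse square of \<open>t\<close>
  have cancelled because \<open>\<mu>\<close> equals \<open>b - b\<^sup>2\<close>. The exponent
  \<open>1 - b + p * b\<close> is positive, so the nonlinear term vanishes at the boundary.\<close>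

definition source :: "real \<Rightarrow> real \<Rightarrow> real" where
  "source t x = E t * (t powr (1 - b + p * b) * x powr p - b * a t * x)"

abbreviation system :: "real \<Rightarrow> (real \<Rightarrow> real) \<Rightarrow> (real \<Rightarrow> real) \<Rightarrow> bool" where
  "system \<equiv> singular_system (2 * b) (\<lambda>t. 1 / E t) source"

lemma E_deriv_interior:
  assumes "0 < t" "t < D"
  shows "(E has_real_derivative a t * E t) (at t)"
  using E_deriv[of t] assms at_within_interior[of t "{0..D}"] by (simp add: interior_atLeastAtMost_real)

lemma cont_E: "continuous_on {0..D} E"
  using E_deriv by (intro DERIV_continuous_on) auto

text \<open>With all powers of \<open>t\<close> expressed through \<open>X\<close>, \<open>P\<close>
  and \<open>t\<close>, checking the equation becomes rational algebra.\<close>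

lemma powr_identities:
  fixes t X P :: real
  assumes t: "0 < t" and X_def: "X = t powr b" and P_def: "P = t powr (p * b)"
  shows "t powr (- b) = 1 / X" "t powr (b - 1) = X / t" "t powr (- b - 1) = 1 / (X * t)"
    "t powr (- (2 * b)) = 1 / X\<^sup>2" "t powr (2 * b - 1) = X\<^sup>2 / t" "t powr (b - 1 - 1) = X / t\<^sup>2"
    "t powr (1 - b + p * b) = t / X * P"
  using t by (simp_all add: X_def P_def powr_diff powr_minus powr_add divide_inverse
      power2_eq_square flip: powr_add)
    (simp_all add: powr_add powr_minus powr_diff power2_eq_square divide_inverse mult_ac)

lemma system_of_solution:
  assumes f: "solution d f" and d: "d \<le> D"
  obtains q where "system d (\<lambda>t. t powr (- b) * f t) q"
proof -
  obtain f' f'' where f'f'': "\<forall>t\<in>{0<..<d}. (f has_real_derivative f' t) (at t) \<and>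
      (f' has_real_derivative f'' t) (at t) \<and> f'' t + a t * f' t + (b - b\<^sup>2) / t\<^sup>2 * f t = f t powr p"
    using f unfolding solution_def by blast
  have f': "(f has_real_derivative f' t) (at t)" and f'': "(f' has_real_derivative f'' t) (at t)"
    and eq: "f'' t + a t * f' t + (b - b\<^sup>2) / t\<^sup>2 * f t = f t powr p"
    and nonneg: "0 \<le> f t" if "0 < t" "t < d" for t
    using f f'f'' that unfolding solution_def by auto
  \<comment> \<open>This is \<open>E t * t powr (2 * b)\<close> times the derivative of
    \<open>t powr (- b) * f t\<close>, written out in \<open>f\<close> and
    \<open>f'\<close>.\<close>
  define q where "q t = E t * (t powr b * f' t - b * t powr (b - 1) * f t)" for t
  have "system d (\<lambda>t. t powr (- b) * f t) q"
    unfolding singular_system_def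
  proof (intro ballI conjI)
    fix t assume "t \<in> {0<..<d}"
    then have t: "0 < t" "t < d" "t < D" using d by auto
    define X where "X = t powr b"
    define P where "P = t powr (p * b)"
    have X: "X > 0" and P: "P > 0" using t by (auto simp: X_def P_def)
    have E: "E t > 0" using E_pos[of t] t by auto
    note pw = powr_identities[OF t(1) X_def P_def]
    have fp: "(t powr (- b) * f t) powr p = f t powr p / P"
      using t nonneg by (simp add: powr_mult powr_powr P_def) (simp add: powr_minus divide_inverse mult_ac)
    have "((\<lambda>t. t powr (- b) * f t) has_real_derivative
        (- b * t powr (- b - 1)) * f t + t powr (- b) * f' t) (at t)"
      by (rule derivative_eq_intros has_real_derivative_powr f' t refl)+ simp
    also have "(- b * t powr (- b - 1)) * f t + t powr (- b) * f' t
        = t powr (- (2 * b)) * (1 / E t * q t)"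
      unfolding q_def pw X_def[symmetric] using X E t by (simp add: field_simps power2_eq_square)
    finally show "((\<lambda>t. t powr (- b) * f t) has_real_derivative t powr (- (2 * b)) * (1 / E t * q t)) (at t)" .
    have "(q has_real_derivative a t * E t * (t powr b * f' t - b * t powr (b - 1) * f t)
        + (b * t powr (b - 1) * f' t + f'' t * t powr b
           - (b * ((b - 1) * t powr (b - 1 - 1)) * f t + f' t * (b * t powr (b - 1)))) * E t) (at t)"
      unfolding q_def
      by (intro DERIV_mult DERIV_diff DERIV_cmult has_real_derivative_powr f' f'' t E_deriv_interior)
    \<comment> \<open>The mixed terms \<open>b * t powr (b - 1) * f' t\<close> cancel, and
      \<open>- b * (b - 1)\<close> supplies the coefficient \<open>b - b\<^sup>2\<close> of the
      equation.\<close>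
    also have "a t * E t * (t powr b * f' t - b * t powr (b - 1) * f t)
        + (b * t powr (b - 1) * f' t + f'' t * t powr b
           - (b * ((b - 1) * t powr (b - 1 - 1)) * f t + f' t * (b * t powr (b - 1)))) * E t
        = E t * X * (f'' t + a t * f' t + (b - b\<^sup>2) / t\<^sup>2 * f t - b * a t * f t / t)"
      unfolding pw X_def[symmetric] using t by (simp add: field_simps power2_eq_square)
    also have "\<dots> = E t * X * (f t powr p - b * a t * f t / t)"
      using eq t by simp
    also have "\<dots> = t powr (2 * b - 1) * source t (t powr (- b) * f t)"
      unfolding source_def fp unfolding pw using X P t by (simp add: field_simps power2_eq_square)
    finally show "(q has_real_derivative t powr (2 * b - 1) * source t (t powr (- b) * f t)) (at t)" .
  qed
  then show ?thesis by (rule that)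
qed

lemma solution_of_system:
  assumes sys: "system d v q" and d: "d \<le> D" and nonneg: "\<And>t. 0 < t \<Longrightarrow> t < d \<Longrightarrow> 0 \<le> v t"
  shows "solution d (\<lambda>t. t powr b * v t)"
  unfolding solution_def
proof (intro conjI ballI exI)
  fix t assume "t \<in> {0<..<d}"
  then have t: "0 < t" "t < d" "t < D" using d by auto
  then show "0 \<le> t powr b * v t" using nonneg by simp
  define X where "X = t powr b"
  define P where "P = t powr (p * b)"
  have X: "X > 0" and P: "P > 0" using t by (auto simp: X_def P_def)
  have E: "E t > 0" using E_pos[of t] t by auto
  note pw = powr_identities[OF t(1) X_def P_def]
  have vp: "(t powr b * v t) powr p = P * v t powr p"
    using t nonneg by (simp add: powr_mult powr_powr P_def mult.commute)
  have dv: "(v has_real_derivative t powr (- (2 * b)) * (1 / E t * q t)) (at t)"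
    and dq: "(q has_real_derivative t powr (2 * b - 1) * source t (v t)) (at t)"
    using sys t unfolding singular_system_def by auto
  \<comment> \<open>The first derivative is stated with \<open>q / E\<close> in place of
    \<open>v'\<close>, so that the second differentiation needs only the two equations of the system
    and the derivative of \<open>E\<close>.\<close>
  let ?f' = "\<lambda>t. b * (t powr (b - 1) * v t) + t powr (- b) * (q t / E t)"
  let ?f'' = "\<lambda>t. b * ((b - 1) * t powr (b - 1 - 1) * v t + t powr (- (2 * b)) * (1 / E t * q t) * t powr (b - 1))
      + (- b * t powr (- b - 1) * (q t / E t)
         + (t powr (2 * b - 1) * source t (v t) * E t - q t * (a t * E t)) / (E t * E t) * t powr (- b))"
  have "((\<lambda>t. t powr b * v t) has_real_derivative
      b * t powr (b - 1) * v t + t powr (- (2 * b)) * (1 / E t * q t) * t powr b) (at t)"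
    by (intro DERIV_mult has_real_derivative_powr dv t)
  also have "b * t powr (b - 1) * v t + t powr (- (2 * b)) * (1 / E t * q t) * t powr b = ?f' t"
    unfolding pw X_def[symmetric] using X E t by (simp add: field_simps power2_eq_square)
  finally show "((\<lambda>t. t powr b * v t) has_real_derivative ?f' t) (at t)" .
  show "(?f' has_real_derivative ?f'' t) (at t)"
    using E by (intro DERIV_add DERIV_mult DERIV_cmult DERIV_divide has_real_derivative_powr
        E_deriv_interior dv dq t) auto
  have "?f'' t + a t * ?f' t + (b - b\<^sup>2) / t\<^sup>2 * (t powr b * v t) = P * v t powr p"
    unfolding source_def pw X_def[symmetric] using X E t by (simp add: field_simps power2_eq_square)
  then show "?f'' t + a t * ?f' t + (b - b\<^sup>2) / t\<^sup>2 * (t powr b * v t) = (t powr b * v t) powr p"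
    by (simp only: vp)
qed

section \<open>Bounds and boundary limits of the coefficients of the system\<close>

lemma source_lipschitz:
  assumes "0 < m"
  obtains K where "0 \<le> K"
    "\<And>t x y. t \<in> {0..D} \<Longrightarrow> 0 \<le> x \<Longrightarrow> m \<le> y \<Longrightarrow> \<bar>source t x - source t y\<bar> \<le> K * \<bar>x - y\<bar>"
proof -
  have "bounded (E ` {0..D})" "bounded (a ` {0..D})"
    using cont_E cont_a by (auto intro!: compact_imp_bounded compact_continuous_image)
  then obtain ME A where ME: "\<And>t. t \<in> {0..D} \<Longrightarrow> \<bar>E t\<bar> \<le> ME" and A: "\<And>t. t \<in> {0..D} \<Longrightarrow> \<bar>a t\<bar> \<le> A"
    unfolding bounded_iff by force
  have ME0: "0 \<le> ME" and A0: "0 \<le> A" using ME[of 0] A[of 0] D by auto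
  define \<gamma> where "\<gamma> = 1 - b + p * b"
  have \<gamma>: "0 < \<gamma>" using b p by (simp add: \<gamma>_def add_pos_pos)
  \<comment> \<open>The concave term contributes the constant of \<open>powr_lipschitz\<close> and
    the linear term the bound \<open>A\<close> for \<open>a\<close>; both carry the bound
    \<open>ME\<close> for \<open>E\<close>.\<close>
  define K where "K = ME * (D powr \<gamma> * m powr (p - 1) + b * A)"
  show ?thesis
  proof (rule that)
    show "0 \<le> K" unfolding K_def using ME0 A0 b by auto
    fix t x y :: real assume t: "t \<in> {0..D}" and x: "0 \<le> x" and y: "m \<le> y"
    have "source t x - source t y = E t * (t powr \<gamma> * (x powr p - y powr p) - b * a t * (x - y))"
      by (simp add: source_def \<gamma>_def algebra_simps)
    also have "\<bar>\<dots>\<bar> \<le> ME * (D powr \<gamma> * (m powr (p - 1) * \<bar>x - y\<bar>) + b * A * \<bar>x - y\<bar>)"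
      unfolding abs_mult
    proof (intro mult_mono ME t)
      have "\<bar>t powr \<gamma> * (x powr p - y powr p)\<bar> \<le> D powr \<gamma> * (m powr (p - 1) * \<bar>x - y\<bar>)"
        unfolding abs_mult using t x y p assms \<gamma>
        by (intro mult_mono powr_lipschitz) (auto intro!: powr_mono2)
      moreover have "\<bar>b * a t * (x - y)\<bar> \<le> b * A * \<bar>x - y\<bar>"
        unfolding abs_mult using A[OF t] b A0 by (intro mult_mono) auto
      ultimately show "\<bar>t powr \<gamma> * (x powr p - y powr p) - b * a t * (x - y)\<bar>
          \<le> D powr \<gamma> * (m powr (p - 1) * \<bar>x - y\<bar>) + b * A * \<bar>x - y\<bar>"
        by linarith
    qed (use ME0 in auto)
    also have "\<dots> = K * \<bar>x - y\<bar>" by (simp add: K_def algebra_simps)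
    finally show "\<bar>source t x - source t y\<bar> \<le> K * \<bar>x - y\<bar>" .
  qed
qed

text \<open>The positive power of \<open>t\<close> removes the nonlinear term in the limit. Hence
  only the first order coefficient \<open>a\<close> of the equation enters the term of order
  \<open>t\<close> in the expansion.\<close>

lemma tendsto_source:
  assumes v: "(v \<longlongrightarrow> v0) (at_right 0)" and v0: "0 < v0"
  shows "((\<lambda>t. source t (v t)) \<longlongrightarrow> - b * a 0 * v0) (at_right 0)"
proof -
  have "1 - b + p * b > 0" using b p by (simp add: add_pos_pos)
  then have pow: "((\<lambda>t::real. t powr (1 - b + p * b)) \<longlongrightarrow> 0) (at_right 0)"
    by (auto intro!: tendsto_eq_intros simp: eventually_at_filter)
  have "((\<lambda>t. source t (v t)) \<longlongrightarrow> 1 * (0 * v0 powr p - b * a 0 * v0)) (at_right 0)"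
    unfolding source_def
    using v0 continuous_on_Icc_at_rightD[OF cont_E D] continuous_on_Icc_at_rightD[OF cont_a D] E_0
    by (intro tendsto_intros pow v) auto
  then show ?thesis by simp
qed

text \<open>\<open>E\<close> has the value 1 and a one-sided derivative at 0, so
  \<open>1 / E - 1\<close> is of order \<open>t\<close>, which is negligible against
  \<open>t powr (2 * b)\<close> because \<open>2 * b < 1\<close>.\<close>

lemma tendsto_inverse_E:
  shows "((\<lambda>t. 1 / E t) \<longlongrightarrow> 1) (at_right 0)"
    and "((\<lambda>t. (1 / E t - 1) / t powr (2 * b)) \<longlongrightarrow> 0) (at_right 0)"
proof -
  have E: "(E \<longlongrightarrow> 1) (at_right 0)"
    using continuous_on_Icc_at_rightD[OF cont_E D] E_0 by simp
  show "((\<lambda>t. 1 / E t) \<longlongrightarrow> 1) (at_right 0)"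
    using tendsto_divide[OF tendsto_const E, of 1] by simp
  have "(E has_real_derivative a 0) (at 0 within {0..D})"
    using E_deriv[of 0] D E_0 by simp
  then have 1: "((\<lambda>t. (E t - 1) / t) \<longlongrightarrow> a 0) (at_right 0)"
    using D by (simp add: has_field_derivative_iff E_0 at_within_Icc_at_right)
  have "((\<lambda>t::real. t powr (1 - 2 * b)) \<longlongrightarrow> 0) (at_right 0)"
    using b by (auto intro!: tendsto_eq_intros simp: eventually_at_filter)
  then have "((\<lambda>t. - ((E t - 1) / t) / E t * t powr (1 - 2 * b)) \<longlongrightarrow> - a 0 / 1 * 0) (at_right 0)"
    by (intro tendsto_intros 1 E) auto
  then have "((\<lambda>t. - ((E t - 1) / t) / E t * t powr (1 - 2 * b)) \<longlongrightarrow> 0) (at_right 0)" by simp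
  then show "((\<lambda>t. (1 / E t - 1) / t powr (2 * b)) \<longlongrightarrow> 0) (at_right 0)"
  proof (rule Lim_transform_eventually)
    show "\<forall>\<^sub>F t in at_right 0. - ((E t - 1) / t) / E t * t powr (1 - 2 * b) = (1 / E t - 1) / t powr (2 * b)"
      using eventually_at_right_real[OF D]
    proof eventually_elim
      case (elim t)
      then show ?case using E_pos[of t] by (simp add: powr_diff field_simps)
    qed
  qed
qed

text \<open>For existence the argument of the source is truncated to \<open>max m x\<close>, which
  makes it Lipschitz on the whole line; near 0 the resulting solution exceeds \<open>m\<close>, so
  the truncation is inactive. For uniqueness a competing solution is turned into a solution of the
  system with the same limits of \<open>v\<close> and \<open>q\<close>.\<close>

lemma exists_unique_solution:
  assumes v0: "0 < v0" and \<mu>: "beta_minus \<mu> = b" and k: "k = - a 0 / 2"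
  obtains d f where "0 < d" "d \<le> D" "solution d f" "has_expansion \<mu> v0 k C f"
    "\<And>d1 w t. 0 < d1 \<Longrightarrow> d1 \<le> d \<Longrightarrow> solution d1 w \<Longrightarrow> has_expansion \<mu> v0 k C w \<Longrightarrow>
      0 < t \<Longrightarrow> t < d1 \<Longrightarrow> w t = f t"
proof -
  define m where "m = v0 / 2"
  have m: "0 < m" "m < v0" using v0 by (auto simp: m_def)
  obtain K where K0: "0 \<le> K"
    and K: "\<And>t x y. t \<in> {0..D} \<Longrightarrow> 0 \<le> x \<Longrightarrow> m \<le> y \<Longrightarrow> \<bar>source t x - source t y\<bar> \<le> K * \<bar>x - y\<bar>"
    using source_lipschitz[OF m(1)] by blast
  have cont_H: "continuous_on {0..D} (\<lambda>t. 1 / E t)"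
    using E_pos by (intro continuous_intros cont_E) force
  then have "bounded ((\<lambda>t. 1 / E t) ` {0..D})"
    by (auto intro!: compact_imp_bounded compact_continuous_image)
  then obtain L where L: "\<And>t. t \<in> {0..D} \<Longrightarrow> \<bar>1 / E t\<bar> \<le> L"
    unfolding bounded_iff by force
  have L0: "0 \<le> L" using order_trans[OF abs_ge_zero L[of 0]] D by auto
  define \<alpha> where "\<alpha> = 2 * b"
  have \<alpha>: "0 < \<alpha>" "\<alpha> < 1" using b by (auto simp: \<alpha>_def)
  \<comment> \<open>The quotient bounds the contraction constant by \<open>1/2\<close>; adding 1 to
    \<open>L * K\<close> keeps the denominator positive.\<close>
  define d0 where "d0 = min D (\<alpha> * (1 - \<alpha>) / (2 * (L * K + 1)))"
  have LK: "0 \<le> L * K" using L0 K0 by simp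
  have d0: "0 < d0" "d0 \<le> D" using D \<alpha> LK by (auto simp: d0_def)
  have small: "L * K * d0 / (\<alpha> * (1 - \<alpha>)) \<le> 1/2"
  proof -
    have "L * K * d0 \<le> (L * K + 1) * (\<alpha> * (1 - \<alpha>) / (2 * (L * K + 1)))"
      using LK d0 by (intro mult_mono) (auto simp: d0_def)
    also have "\<dots> = \<alpha> * (1 - \<alpha>) / 2" using LK by (simp add: field_simps)
    finally show ?thesis using \<alpha> by (simp add: field_simps)
  qed
  \<comment> \<open>The coefficient of \<open>t powr (1 - \<alpha>)\<close> in the asymptotics is
    \<open>c / (1 - \<alpha>)\<close>, which this choice makes equal to \<open>C\<close>.\<close>
  define c where "c = C * (1 - \<alpha>)"
  have "\<exists>v q. singular_system \<alpha> (\<lambda>t. 1 / E t) (\<lambda>t x. source t (max m x)) d0 v q \<and>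
    (v \<longlongrightarrow> v0) (at_right 0) \<and> (q \<longlongrightarrow> c) (at_right 0)"
  proof (rule singular_system_exists[OF \<alpha> d0(1), where L = L and K = K
        and H = "\<lambda>t. 1 / E t" and g = "\<lambda>t x. source t (max m x)"])
    show "continuous_on {0..d0} (\<lambda>t. 1 / E t)"
      using cont_H by (rule continuous_on_subset) (use d0 in auto)
    show "\<bar>1 / E t\<bar> \<le> L" if "t \<in> {0..d0}" for t using that d0 by (intro L) auto
    show "continuous_on {0..d0} (\<lambda>t. source t (max m (v t)))" if "continuous_on {0..d0} v" for v
    proof -
      have "1 - b + p * b > 0" using b p by (simp add: add_pos_pos)
      then have "continuous_on {0..d0} (\<lambda>t::real. t powr (1 - b + p * b))"
        by (intro continuous_on_powr' continuous_on_id continuous_on_const) auto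
      moreover have "continuous_on {0..d0} E" "continuous_on {0..d0} a"
        using cont_E cont_a d0 by (auto elim: continuous_on_subset)
      moreover have "continuous_on {0..d0} (\<lambda>t. max m (v t) powr p)"
        using m by (intro continuous_on_powr' continuous_intros that) auto
      ultimately show ?thesis
        unfolding source_def by (intro continuous_on_mult continuous_on_diff continuous_on_max that continuous_on_const)
    qed
    show "\<bar>source t (max m x) - source t (max m y)\<bar> \<le> K * \<bar>x - y\<bar>" if "t \<in> {0..d0}" for t x y
    proof -
      have "\<bar>source t (max m x) - source t (max m y)\<bar> \<le> K * \<bar>max m x - max m y\<bar>"
        using that d0 m by (intro K) auto
      also have "\<dots> \<le> K * \<bar>x - y\<bar>" using K0 by (intro mult_left_mono) auto
      finally show ?thesis .
    qed
  qed (use small in auto)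
  then obtain v q where sys0: "singular_system \<alpha> (\<lambda>t. 1 / E t) (\<lambda>t x. source t (max m x)) d0 v q"
    and v: "(v \<longlongrightarrow> v0) (at_right 0)" and q: "(q \<longlongrightarrow> c) (at_right 0)" by blast
  have "\<forall>\<^sub>F t in at_right 0. m < v t" using v m(2) by (rule order_tendstoD)
  then obtain d1 where d1: "0 < d1" "\<And>t. 0 < t \<Longrightarrow> t < d1 \<Longrightarrow> m < v t"
    unfolding eventually_at_right_field by auto
  define d where "d = min d0 d1"
  have d: "0 < d" "d \<le> d0" "d \<le> D" using d0 d1 by (auto simp: d_def)
  have vm: "m < v t" if "0 < t" "t < d" for t using d1 that by (auto simp: d_def)
  have sys: "system d v q"
    using sys0 vm d unfolding singular_system_def \<alpha>_def by (force simp: max_def)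
  have asym: "((\<lambda>t. (v t - v0) / t powr (1 - \<alpha>)) \<longlongrightarrow> c / (1 - \<alpha>)) (at_right 0)"
    "((\<lambda>t. (v t - v0 - c / (1 - \<alpha>) * t powr (1 - \<alpha>) - (- b * a 0 * v0) / \<alpha> * t) / t) \<longlongrightarrow> 0) (at_right 0)"
    if "0 < d" "system d v q" "(v \<longlongrightarrow> v0) (at_right 0)" "(q \<longlongrightarrow> c) (at_right 0)" for d v q c
    using singular_system_asymptotics[OF \<alpha>, of d "\<lambda>t. 1 / E t" source v q v0 c "- b * a 0 * v0"]
      that tendsto_inverse_E tendsto_source[OF that(3) v0] unfolding \<alpha>_def by blast+
  \<comment> \<open>The factor \<open>b\<close> cancels against \<open>\<alpha> = 2 * b\<close>;
    this is the origin of the value \<open>- a 0 / 2\<close> of \<open>k\<close>.\<close>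
  have coeff: "(- b * a 0 * v0) / \<alpha> = v0 * k" using b by (simp add: \<alpha>_def k)
  define f where "f = (\<lambda>t. t powr b * v t)"
  have expansion: "has_expansion \<mu> v0 k C w \<longleftrightarrow>
    ((\<lambda>t. (t powr (- b) * w t - v0 - C * t powr (1 - \<alpha>) - v0 * k * t) / t) \<longlongrightarrow> 0) (at_right 0)" for w
    using has_expansion_iff[OF \<mu>, of v0 k C w] v0 by (simp add: \<alpha>_def)
  show ?thesis
  proof (rule that[OF d(1,3)])
    show "solution d f"
      unfolding f_def using sys d(3) vm m by (intro solution_of_system) force+
    have "((\<lambda>t. (v t - v0 - C * t powr (1 - \<alpha>) - v0 * k * t) / t) \<longlongrightarrow> 0) (at_right 0)"
      using asym(2)[OF d(1) sys v q] \<alpha> unfolding coeff by (simp add: c_def)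
    then show "has_expansion \<mu> v0 k C f"
      unfolding expansion
    proof (rule Lim_transform_eventually)
      show "\<forall>\<^sub>F t in at_right 0. (v t - v0 - C * t powr (1 - \<alpha>) - v0 * k * t) / t =
          (t powr (- b) * f t - v0 - C * t powr (1 - \<alpha>) - v0 * k * t) / t"
        using eventually_at_right_real[OF d(1)] by eventually_elim (auto simp: f_def powr_minus)
    qed
  next
    fix d2 w t
    assume d2: "0 < d2" "d2 \<le> d" and w: "solution d2 w" "has_expansion \<mu> v0 k C w" and t: "0 < t" "t < d2"
    define v2 where "v2 = (\<lambda>t. t powr (- b) * w t)"
    obtain q2 where sys2: "system d2 v2 q2"
      using system_of_solution[OF w(1)] d2 d unfolding v2_def by auto
    have "((\<lambda>t. (v2 t - v0 - C * t powr (1 - \<alpha>) - v0 * k * t) / t) \<longlongrightarrow> 0) (at_right 0)"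
      using w(2) unfolding expansion v2_def .
    note v2 = tendsto_of_expansion[OF \<alpha> this]
    \<comment> \<open>The limit of \<open>q2\<close> is not given in advance; it exists because the
      source along \<open>v2\<close> converges.\<close>
    obtain c' where c': "(q2 \<longlongrightarrow> c') (at_right 0)"
    proof (rule limit_of_weighted_derivative[OF \<alpha>(1) d2(1), of q2 "\<lambda>t. source t (v2 t)"])
      fix s assume s: "0 < s" "s < d2"
      show "(q2 has_real_derivative s powr (\<alpha> - 1) * source s (v2 s)) (at s)"
        using sys2 s unfolding singular_system_def \<alpha>_def by auto
      have "isCont v2 s"
        using sys2 s unfolding singular_system_def by (meson DERIV_isCont greaterThanLessThan_iff)
      moreover have "isCont E s" using E_deriv_interior[of s] s d2 d by (intro DERIV_isCont) auto
      moreover have "isCont a s"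
        using continuous_on_interior[OF cont_a, of s] s d2 d by (simp add: interior_atLeastAtMost_real)
      moreover have "isCont (\<lambda>t. v2 t powr p) s"
      proof -
        have "\<forall>\<^sub>F x in at s. x \<in> {0<..<d2}"
          using s by (intro eventually_at_in_open') auto
        then have "\<forall>\<^sub>F x in at s. 0 \<le> v2 x"
          by eventually_elim (use w(1) in \<open>auto simp: v2_def solution_def\<close>)
        then show ?thesis
          using \<open>isCont v2 s\<close> p unfolding isCont_def by (intro tendsto_powr') auto
      qed
      moreover have "isCont (\<lambda>t. t powr (1 - b + p * b)) s"
        using s by (intro DERIV_isCont[OF has_real_derivative_powr]) auto
      ultimately show "isCont (\<lambda>t. source t (v2 t)) s"
        unfolding source_def by (intro continuous_mult continuous_diff continuous_const)
    qed (use tendsto_source[OF v2(1) v0] in auto)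
    have "c' / (1 - \<alpha>) = C"
      using asym(1)[OF d2(1) sys2 v2(1) c'] v2(2) by (rule tendsto_unique[rotated]) simp
    then have q2: "(q2 \<longlongrightarrow> c) (at_right 0)" using c' \<alpha> by (auto simp: c_def)
    have "v2 t = v t"
    proof (rule singular_system_unique[where g = source and H = "\<lambda>t. 1 / E t" and \<alpha> = \<alpha> and d = d2
          and L = L and K = K and ?v1.0 = v2 and ?v2.0 = v and ?q1.0 = q2 and ?q2.0 = q and t = t])
      show "singular_system \<alpha> (\<lambda>t. 1 / E t) source d2 v2 q2" using sys2 by (simp add: \<alpha>_def)
      show "singular_system \<alpha> (\<lambda>t. 1 / E t) source d2 v q"
        using sys d2 by (simp add: \<alpha>_def singular_system_def)
      show "\<bar>1 / E s\<bar> \<le> L" if "0 < s" "s < d2" for s using that d2 d by (intro L) auto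
      show "\<bar>source s (v2 s) - source s (v s)\<bar> \<le> K * \<bar>v2 s - v s\<bar>" if "0 < s" "s < d2" for s
        using that d2 d vm[of s] w(1) by (intro K) (auto simp: v2_def solution_def)
      have "L * K * d2 / \<alpha> \<le> L * K * d0 / (\<alpha> * (1 - \<alpha>))"
      proof (rule frac_le)
        show "L * K * d2 \<le> L * K * d0" using LK d2 d by (intro mult_left_mono) auto
        show "\<alpha> * (1 - \<alpha>) \<le> \<alpha>" using \<alpha> by (intro mult_left_le) auto
        show "0 \<le> L * K * d0" using L0 K0 d0 by simp
        show "0 < \<alpha> * (1 - \<alpha>)" using \<alpha> by simp
      qed
      then show "L * K * d2 / \<alpha> \<le> 1/2" using small by linarith
    qed (use \<alpha> v q v2 q2 K0 t in auto)
    then have "f t = (t powr b * t powr (- b)) * w t" by (simp add: f_def v2_def flip: mult.assoc)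
    also have "t powr b * t powr (- b) = 1" using t by (simp flip: powr_add)
    finally show "w t = f t" by simp
  qed
qed

end

lemma radial_exists_unique_local_solution:
  fixes \<sigma> \<rho> \<omega> :: real
  assumes \<sigma>: "\<sigma> * \<sigma> = 1" and \<rho>: "0 < \<rho>" and \<omega>: "0 < \<omega>"
    and \<Omega>: "\<And>r. r \<in> \<Omega> \<Longrightarrow> 0 < e r \<and> r = \<rho> + \<sigma> * e r"
    and e: "\<And>t. 0 < t \<Longrightarrow> t < \<omega> \<Longrightarrow> \<rho> + \<sigma> * t \<in> \<Omega> \<and> e (\<rho> + \<sigma> * t) = t \<and> \<delta> (\<rho> + \<sigma> * t) = t"
    and p: "0 < p" "p < 1" and \<mu>: "\<mu> < 1/4" and \<beta>: "beta_minus \<mu> \<in> {0<..<1/2}" and v0: "0 < v0"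
    and k: "k = - \<sigma> * (real N - 1) / (2 * \<rho>)"
  shows "exists_unique_local_solution N \<mu> p \<Omega> \<delta> e (\<lambda>u. has_expansion \<mu> v0 k C (\<lambda>t. u (\<rho> + \<sigma> * t)))"
proof -
  define n where "n = real N - 1"
  define b where "b = beta_minus \<mu>"
  define D where "D = min \<omega> \<rho> / 2"
  define a where "a = (\<lambda>t. \<sigma> * n / (\<rho> + \<sigma> * t))"
  define E where "E = (\<lambda>t. ((\<rho> + \<sigma> * t) / \<rho>) powr n)"
  have \<mu>b: "\<mu> = b - b\<^sup>2"
    using \<mu> by (simp add: b_def beta_minus_def power2_eq_square algebra_simps)
  have D_less: "0 < D" "D < \<omega>" "D < \<rho>" using \<omega> \<rho> by (auto simp: D_def)
  have \<sigma>1: "\<sigma> = 1 \<or> \<sigma> = -1" using \<sigma> by (simp add: square_eq_1_iff)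
  have pos: "0 < \<rho> + \<sigma> * t" if "0 \<le> t" "t \<le> D" for t using \<sigma>1 that D_less by auto
  interpret boundary_equation b p D a E
  proof
    show "continuous_on {0..D} a"
      unfolding a_def using pos by (intro continuous_intros) force
    show "0 < E t" if "t \<in> {0..D}" for t using pos[of t] that \<rho> by (auto simp: E_def)
    show "(E has_real_derivative a t * E t) (at t within {0..D})" if "t \<in> {0..D}" for t
    proof (rule has_field_derivative_at_within)
      let ?x = "(\<rho> + \<sigma> * t) / \<rho>"
      have x: "?x > 0" using pos[of t] that \<rho> by auto
      have "((\<lambda>t. (\<rho> + \<sigma> * t) / \<rho>) has_real_derivative \<sigma> / \<rho>) (at t)"
        using \<rho> by (auto intro!: derivative_eq_intros)
      from DERIV_chain2[OF has_real_derivative_powr[OF x, of n] this]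
      have "(E has_real_derivative n * ?x powr (n - 1) * (\<sigma> / \<rho>)) (at t)" by (simp add: E_def)
      also have "n * ?x powr (n - 1) * (\<sigma> / \<rho>) = a t * E t"
        using \<rho> pos[of t] that by (simp add: a_def E_def powr_diff field_simps)
      finally show "(E has_real_derivative a t * E t) (at t)" .
    qed
  qed (use \<beta> p D_less \<rho> in \<open>auto simp: b_def E_def\<close>)
  have mem: "r \<in> {r \<in> \<Omega>. e r < d} \<longleftrightarrow> (\<exists>t\<in>{0<..<d}. r = \<rho> + \<sigma> * t)" if "d \<le> D" for r d
  proof
    assume "r \<in> {r \<in> \<Omega>. e r < d}"
    then show "\<exists>t\<in>{0<..<d}. r = \<rho> + \<sigma> * t" using \<Omega>[of r] by auto
  next
    assume "\<exists>t\<in>{0<..<d}. r = \<rho> + \<sigma> * t"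
    then obtain t where "t \<in> {0<..<d}" "r = \<rho> + \<sigma> * t" by blast
    then show "r \<in> {r \<in> \<Omega>. e r < d}" using e[of t] D_less that by auto
  qed
  have iff: "radial_solution N \<mu> p \<delta> {r \<in> \<Omega>. e r < d} u \<longleftrightarrow> solution d (\<lambda>t. u (\<rho> + \<sigma> * t))"
    if d: "d \<le> D" for d u
  proof
    assume "radial_solution N \<mu> p \<delta> {r \<in> \<Omega>. e r < d} u"
    then obtain u' u'' where u: "\<And>r. r \<in> {r \<in> \<Omega>. e r < d} \<Longrightarrow>
        0 \<le> u r \<and> (u has_real_derivative u' r) (at r) \<and> (u' has_real_derivative u'' r) (at r) \<and>
        u'' r + (real N - 1) / r * u' r + \<mu> / (\<delta> r)\<^sup>2 * u r = u r powr p"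
      unfolding radial_solution_def by blast
    show "solution d (\<lambda>t. u (\<rho> + \<sigma> * t))"
      unfolding solution_def
    proof (intro conjI ballI exI)
      fix t assume t: "t \<in> {0<..<d}"
      define r where "r = \<rho> + \<sigma> * t"
      have "r \<in> {r \<in> \<Omega>. e r < d}" using mem[OF d, of r] t r_def by blast
      note u = u[OF this, unfolded r_def]
      have lin: "((\<lambda>t. \<rho> + \<sigma> * t) has_real_derivative \<sigma>) (at t)"
        by (auto intro!: derivative_eq_intros)
      show "0 \<le> u (\<rho> + \<sigma> * t)" using u by simp
      show "((\<lambda>t. u (\<rho> + \<sigma> * t)) has_real_derivative u' (\<rho> + \<sigma> * t) * \<sigma>) (at t)"
        using DERIV_chain2[OF _ lin] u by blast
      have "((\<lambda>t. u' (\<rho> + \<sigma> * t)) has_real_derivative u'' (\<rho> + \<sigma> * t) * \<sigma>) (at t)"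
        using DERIV_chain2[OF _ lin] u by blast
      from DERIV_cmult_right[OF this, of \<sigma>]
      show "((\<lambda>t. u' (\<rho> + \<sigma> * t) * \<sigma>) has_real_derivative u'' (\<rho> + \<sigma> * t)) (at t)"
        using \<sigma> by (simp add: mult.assoc)
      have "\<delta> (\<rho> + \<sigma> * t) = t" using e[of t] t d D_less by auto
      moreover have "a t * (u' (\<rho> + \<sigma> * t) * \<sigma>) = n / (\<rho> + \<sigma> * t) * u' (\<rho> + \<sigma> * t)"
        using \<sigma> by (simp add: a_def mult_ac)
      ultimately show "u'' (\<rho> + \<sigma> * t) + a t * (u' (\<rho> + \<sigma> * t) * \<sigma>) + (b - b\<^sup>2) / t\<^sup>2 * u (\<rho> + \<sigma> * t)
          = u (\<rho> + \<sigma> * t) powr p"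
        using u by (simp add: n_def \<mu>b)
    qed
  next
    assume sol: "solution d (\<lambda>t. u (\<rho> + \<sigma> * t))"
    define f where "f = (\<lambda>t. u (\<rho> + \<sigma> * t))"
    obtain f' f'' where f: "\<And>t. t \<in> {0<..<d} \<Longrightarrow>
        0 \<le> f t \<and> (f has_real_derivative f' t) (at t) \<and> (f' has_real_derivative f'' t) (at t) \<and>
        f'' t + a t * f' t + (b - b\<^sup>2) / t\<^sup>2 * f t = f t powr p"
      using sol unfolding solution_def f_def[symmetric] by blast
    have u_f: "u r = f (\<sigma> * (r - \<rho>))" for r
      using \<sigma> by (simp add: f_def flip: mult.assoc)
    have u_eq: "u = (\<lambda>r. f (\<sigma> * (r - \<rho>)))" using u_f by blast
    show "radial_solution N \<mu> p \<delta> {r \<in> \<Omega>. e r < d} u"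
      unfolding radial_solution_def
    proof (intro conjI ballI exI)
      fix r assume "r \<in> {r \<in> \<Omega>. e r < d}"
      then obtain t where t: "t \<in> {0<..<d}" and r: "r = \<rho> + \<sigma> * t" using mem[OF d] by blast
      have s: "\<sigma> * (r - \<rho>) = t" using \<sigma> by (simp add: r flip: mult.assoc)
      note f = f[OF t]
      have lin: "((\<lambda>r. \<sigma> * (r - \<rho>)) has_real_derivative \<sigma>) (at r)"
        by (auto intro!: derivative_eq_intros)
      show "0 \<le> u r" using f by (simp add: u_f s)
      show "(u has_real_derivative f' (\<sigma> * (r - \<rho>)) * \<sigma>) (at r)"
        unfolding u_eq using f by (intro DERIV_chain2[OF _ lin]) (simp add: s)
      have "((\<lambda>r. f' (\<sigma> * (r - \<rho>))) has_real_derivative f'' (\<sigma> * (r - \<rho>)) * \<sigma>) (at r)"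
        using f by (intro DERIV_chain2[OF _ lin]) (simp add: s)
      from DERIV_cmult_right[OF this, of \<sigma>]
      show "((\<lambda>r. f' (\<sigma> * (r - \<rho>)) * \<sigma>) has_real_derivative f'' (\<sigma> * (r - \<rho>))) (at r)"
        using \<sigma> by (simp add: mult.assoc)
      have "\<delta> r = t" using e[of t] t d D_less by (auto simp: r)
      moreover have "(real N - 1) / r * (f' t * \<sigma>) = a t * f' t"
        by (simp add: a_def r n_def mult_ac)
      ultimately show "f'' (\<sigma> * (r - \<rho>)) + (real N - 1) / r * (f' (\<sigma> * (r - \<rho>)) * \<sigma>)
          + \<mu> / (\<delta> r)\<^sup>2 * u r = u r powr p"
        using f by (simp add: u_f s \<mu>b)
    qed
  qed
  have "k = - a 0 / 2" by (simp add: k a_def n_def)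
  from exists_unique_solution[OF v0 b_def[symmetric] this, of C]
  obtain d f where d: "0 < d" "d \<le> D" and f: "solution d f" "has_expansion \<mu> v0 k C f"
    and uniq: "\<And>d1 w t. 0 < d1 \<Longrightarrow> d1 \<le> d \<Longrightarrow> solution d1 w \<Longrightarrow> has_expansion \<mu> v0 k C w \<Longrightarrow>
      0 < t \<Longrightarrow> t < d1 \<Longrightarrow> w t = f t"
    by metis
  define u where "u = (\<lambda>r. f (\<sigma> * (r - \<rho>)))"
  have u: "u (\<rho> + \<sigma> * t) = f t" for t using \<sigma> by (simp add: u_def flip: mult.assoc)
  show ?thesis
    unfolding exists_unique_local_solution_def
  proof (intro exI conjI allI impI ballI)
    show "0 < d" by (rule d)
    show "radial_solution N \<mu> p \<delta> {r \<in> \<Omega>. e r < d} u" using iff[OF d(2)] f by (simp add: u)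
    show "has_expansion \<mu> v0 k C (\<lambda>t. u (\<rho> + \<sigma> * t))" using f by (simp add: u)
    fix d1 w r
    assume d1: "0 < d1" and r: "r \<in> \<Omega>" "e r < min d d1"
      and w: "radial_solution N \<mu> p \<delta> {r \<in> \<Omega>. e r < d1} w \<and> has_expansion \<mu> v0 k C (\<lambda>t. w (\<rho> + \<sigma> * t))"
    have "radial_solution N \<mu> p \<delta> {r \<in> \<Omega>. e r < min d d1} w"
      using w unfolding radial_solution_def by auto
    then have "solution (min d d1) (\<lambda>t. w (\<rho> + \<sigma> * t))" using iff[of "min d d1" w] d by auto
    moreover have er: "0 < e r" "\<rho> + \<sigma> * e r = r" using \<Omega>[OF r(1)] by auto
    ultimately have "w (\<rho> + \<sigma> * e r) = f (e r)"
      using w r d d1 by (intro uniq[of "min d d1"]) auto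
    then show "w r = u r" using u[of "e r"] by (simp add: er)
  qed
qed

theorem lemma2p6:
  fixes N :: nat and p \<mu> r0 R v0 C :: real
  assumes "N \<ge> 1" and "0 < p" and "p < 1"
    and "\<mu> < 1/4" and "beta_minus \<mu> \<in> {0<..<1/2}"
    and "0 < r0" and "r0 < R"
    and "v0 > 0"
  shows
    "exists_unique_local_solution N \<mu> p {r0<..<R} (annulus_dist r0 R) (\<lambda>r. R - r)
       (\<lambda>u. has_expansion \<mu> v0 ((real N - 1) / (2 * R)) C (\<lambda>\<delta>. u (R - \<delta>))) \<and>
     exists_unique_local_solution N \<mu> p {r0<..<R} (annulus_dist r0 R) (\<lambda>r. r - r0)
       (\<lambda>u. has_expansion \<mu> v0 (- ((real N - 1) / (2 * r0))) C (\<lambda>\<delta>. u (r0 + \<delta>))) \<and>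
     exists_unique_local_solution N \<mu> p {0<..<R} (\<lambda>r. R - r) (\<lambda>r. R - r)
       (\<lambda>u. has_expansion \<mu> v0 ((real N - 1) / (2 * R)) C (\<lambda>\<delta>. u (R - \<delta>)))"
proof (intro conjI)
  have "exists_unique_local_solution N \<mu> p {r0<..<R} (annulus_dist r0 R) (\<lambda>r. R - r)
       (\<lambda>u. has_expansion \<mu> v0 ((real N - 1) / (2 * R)) C (\<lambda>t. u (R + (- 1) * t)))"
  proof (rule radial_exists_unique_local_solution[where \<omega> = "(R - r0) / 2"])
    show "R + (- 1) * t \<in> {r0<..<R} \<and> R - (R + (- 1) * t) = t \<and> annulus_dist r0 R (R + (- 1) * t) = t"
      if "0 < t" "t < (R - r0) / 2" for t
      using assms that by (auto simp: annulus_dist_def min_def field_simps)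
  qed (use assms in simp_all)
  then show "exists_unique_local_solution N \<mu> p {r0<..<R} (annulus_dist r0 R) (\<lambda>r. R - r)
       (\<lambda>u. has_expansion \<mu> v0 ((real N - 1) / (2 * R)) C (\<lambda>\<delta>. u (R - \<delta>)))"
    by simp
  have "exists_unique_local_solution N \<mu> p {r0<..<R} (annulus_dist r0 R) (\<lambda>r. r - r0)
       (\<lambda>u. has_expansion \<mu> v0 (- ((real N - 1) / (2 * r0))) C (\<lambda>t. u (r0 + 1 * t)))"
  proof (rule radial_exists_unique_local_solution[where \<omega> = "(R - r0) / 2"])
    show "r0 + 1 * t \<in> {r0<..<R} \<and> r0 + 1 * t - r0 = t \<and> annulus_dist r0 R (r0 + 1 * t) = t"
      if "0 < t" "t < (R - r0) / 2" for t
      using assms that by (auto simp: annulus_dist_def min_def field_simps)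
    show "- ((real N - 1) / (2 * r0)) = - 1 * (real N - 1) / (2 * r0)"
      by (simp only: minus_divide_left mult_minus_left mult_1_left)
  qed (use assms in simp_all)
  then show "exists_unique_local_solution N \<mu> p {r0<..<R} (annulus_dist r0 R) (\<lambda>r. r - r0)
       (\<lambda>u. has_expansion \<mu> v0 (- ((real N - 1) / (2 * r0))) C (\<lambda>\<delta>. u (r0 + \<delta>)))"
    by simp
  have "exists_unique_local_solution N \<mu> p {0<..<R} (\<lambda>r. R - r) (\<lambda>r. R - r)
       (\<lambda>u. has_expansion \<mu> v0 ((real N - 1) / (2 * R)) C (\<lambda>t. u (R + (- 1) * t)))"
    by (rule radial_exists_unique_local_solution[where \<omega> = R]) (use assms in simp_all)
  then show "exists_unique_local_solution N \<mu> p {0<..<R} (\<lambda>r. R - r) (\<lambda>r. R - r)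
       (\<lambda>u. has_expansion \<mu> v0 ((real N - 1) / (2 * R)) C (\<lambda>\<delta>. u (R - \<delta>)))"
    by simp
qed

end
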